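(* Let $u:[0,1]\to\mathbb{R}$ be increasing (i.e. non-decreasing), piecewise continuous and single-crossing (from below). Suppose that Problem $(P)$ (uniform prior on $[0,1]$) has an interior optimal solution $p^*$, i.e. an optimal solution with $0<p^*(t)<1$ for all $t\in[0,1]$. Then $p^*$ is sigmoidal: there exists $\tau\in(0,1)$ such that the derivative $(p^* )'$ is increasing (non-decreasing) on $[0,\tau)$ and decreasing (non-increasing) on $(\tau,1]$.
   Context: Piecewise continuous: $u:[0,1]\to\mathbb{R}$ is piecewise continuous if there are $0=t_0<t_1<\dots<t_N=1$ such that $u$ is continuous on each $(t_i,t_{i+1})$, $i=0,\dots,N-1$, the left limits of $u$ exist and are finite at $t_1,\dots,t_N$, and the right limits exist and are finite at $t_0,\dots,t_{N-1}$. Single-crossing (from below): there exists $t_u\in[0,1]$ with $u(t)<0$ on $[0,t_u)$ and $u(t)>0$ on $(t_u,1]$. Problem $(P)$ (state space $[0,1]$, uniform prior, cost scale $1$): minimize over absolutely continuous $p:[0,1]\to[0,1]$ the functional $$J^P[p]=\int_0^1 \left(\frac{(p'(t))^2}{p(t)(1-p(t))}-u(t)p(t)\right)dt,$$ where the quotient is taken to be $0$ if $p(t)\in\{0,1\}$ and $p'(t)=0$, and $+\infty$ if $p(t)\in\{0,1\}$ and $p'(t)\neq0$. An (optimal) solution is a $p_*$ with $J^P[p_*]<+\infty$ and $J^P[p_*]\le J^P[p]$ for all absolutely continuous $p:[0,1]\to[0,1]$. *)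

theory Defs
  imports "HOL-Analysis.Analysis"
begin

definition piecewise_continuous :: "(real \<Rightarrow> real) \<Rightarrow> bool" where
  "piecewise_continuous u \<longleftrightarrow>
     (\<exists>(N::nat) (t::nat \<Rightarrow> real). t 0 = 0 \<and> t N = 1 \<and>
        (\<forall>i<N. t i < t (Suc i) \<and>
               continuous_on {t i<..<t (Suc i)} u \<and>
               (\<exists>l. (u \<longlongrightarrow> l) (at_left (t (Suc i)))) \<and>
               (\<exists>r. (u \<longlongrightarrow> r) (at_right (t i)))))"

definition single_crossing :: "(real \<Rightarrow> real) \<Rightarrow> bool" where
  "single_crossing u \<longleftrightarrow>
     (\<exists>t\<^sub>u\<in>{0..1}. (\<forall>t\<in>{0..<t\<^sub>u}. u t < 0) \<and> (\<forall>t\<in>{t\<^sub>u<..1}. u t > 0))"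

text \<open>
  Absolute continuity of a function on a set (here always an interval); unrelated to
  \<^const>\<open>absolutely_continuous\<close>, which is about measures.
\<close>

definition absolutely_continuous_on :: "real set \<Rightarrow> (real \<Rightarrow> real) \<Rightarrow> bool" where
  "absolutely_continuous_on S f \<longleftrightarrow>
     (\<forall>\<epsilon>>0. \<exists>\<delta>>0. \<forall>(n::nat) a b.
        (\<forall>i<n. a i \<le> b i \<and> {a i..b i} \<subseteq> S) \<longrightarrow>
        disjoint_family_on (\<lambda>i. {a i<..<b i}) {..<n} \<longrightarrow>
        (\<Sum>i<n. b i - a i) < \<delta> \<longrightarrow>
        (\<Sum>i<n. \<bar>f (b i) - f (a i)\<bar>) < \<epsilon>)"

text \<open>
  The derivative relative to \<open>[0,1]\<close>: one-sided at the end points, and insensitive to the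
  values of the function outside \<open>[0,1]\<close>. It is unspecified where the function is not
  differentiable, which for an absolutely continuous function is a null set.
\<close>

definition deriv01 :: "(real \<Rightarrow> real) \<Rightarrow> real \<Rightarrow> real" where
  "deriv01 p t = vector_derivative p (at t within {0..1})"

text \<open>
  The Lebesgue integral of an extended real-valued function, as the integral of the positive
  part minus that of the negative part (\<^const>\<open>e2ennreal\<close> maps negative values to 0). For
  piecewise continuous \<open>u\<close> the negative part of the integrand in \<open>J_P\<close> is bounded, so that
  no difference of infinities arises there.
\<close>

definition ereal_integral :: "'a measure \<Rightarrow> ('a \<Rightarrow> ereal) \<Rightarrow> ereal" where
  "ereal_integral M F =
     enn2ereal (\<integral>\<^sup>+ x. e2ennreal (F x) \<partial>M) - enn2ereal (\<integral>\<^sup>+ x. e2ennreal (- F x) \<partial>M)"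

definition cost_rate :: "(real \<Rightarrow> real) \<Rightarrow> real \<Rightarrow> ereal" where
  "cost_rate p t =
     (if p t \<in> {0, 1} then (if deriv01 p t = 0 then 0 else \<infinity>)
      else ereal ((deriv01 p t)\<^sup>2 / (p t * (1 - p t))))"

definition J_P :: "(real \<Rightarrow> real) \<Rightarrow> (real \<Rightarrow> real) \<Rightarrow> ereal" where
  "J_P u p = ereal_integral (lebesgue_on {0..1}) (\<lambda>t. cost_rate p t - ereal (u t * p t))"

definition admissible :: "(real \<Rightarrow> real) \<Rightarrow> bool" where
  "admissible p \<longleftrightarrow> absolutely_continuous_on {0..1} p \<and> p \<in> {0..1} \<rightarrow> {0..1}"

definition optimal_solution :: "(real \<Rightarrow> real) \<Rightarrow> (real \<Rightarrow> real) \<Rightarrow> bool" where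
  "optimal_solution u p \<longleftrightarrow>
     admissible p \<and> J_P u p < \<infinity> \<and> (\<forall>q. admissible q \<longrightarrow> J_P u p \<le> J_P u q)"

definition interior_path :: "(real \<Rightarrow> real) \<Rightarrow> bool" where
  "interior_path p \<longleftrightarrow> (\<forall>t\<in>{0..1}. 0 < p t \<and> p t < 1)"

definition sigmoidal :: "(real \<Rightarrow> real) \<Rightarrow> bool" where
  "sigmoidal p \<longleftrightarrow>
     p differentiable_on {0..1} \<and>
     (\<exists>\<tau>\<in>{0<..<1}. mono_on {0..<\<tau>} (deriv01 p) \<and> antimono_on {\<tau><..1} (deriv01 p))"

end

theory Submission
  imports Defs
begin

text \<open>Write \<open>p = (sin \<theta>)\<^sup>2\<close>. The cost becomes \<open>4 (\<theta>')\<^sup>2\<close>, and stationarity under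
  \<open>\<theta> + \<epsilon> \<eta>\<close> shows that \<open>\<theta>\<close> is continuously differentiable with
  \<open>\<theta>' t = R t = 1/8 \<integral>\<^sub>t\<^sup>1 u sin (2 \<theta>)\<close> and \<open>R 0 = R 1 = 0\<close>, so \<open>R > 0\<close> inside by single crossing.
  Hence \<open>p' = R sin (2 \<theta>)\<close> is absolutely continuous and \<open>p''\<close> has the sign of \<open>K - u\<close> with
  \<open>K = 16 cos (2 \<theta>) R\<^sup>2 / (sin (2 \<theta>))\<^sup>2\<close>. Wherever \<open>K\<close> meets \<open>u\<close> it has a negative right derivative,
  while \<open>u\<close> does not decrease, so \<open>p''\<close> changes sign at most once, from positive to negative;
  since \<open>p'\<close> vanishes at both ends, it does so at an interior point.

  Even to make sense of the cost of an absolutely continuous path one needs Lebesgue's theorem on its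
  differentiability almost everywhere and the corresponding fundamental theorem of calculus, which
  are derived from Vitali's covering theorem.\<close>

section \<open>Absolutely continuous functions\<close>

text \<open>The angle removes the state constraint: (sin x)^2 lies in [0,1] for every x, so every
  Lipschitz variation of \<theta> is admissible, and the cost is exactly quadratic in the size of
  the variation. The reward differs from its linearization by a quadratic remainder. Hence a
  competitor's cost lies below a quadratic polynomial in the size whose value at 0 is the optimal
  cost, and stationarity follows by comparing coefficients, from square integrability of \<theta>'
  alone. The constants: p' = \<theta>' sin (2 \<theta>) and (sin (2 \<theta>))^2 = 4 p (1 - p) give
  the cost 4 (\<theta>')^2, whence 8 \<theta>'' = - u sin (2 \<theta>), and solving p'' = 0 for u
  gives the 16 in K. The obstacle at the end is that u may jump, so p'' is available only almost
  everywhere. Its sign is therefore used through integrals, and meeting points of K and u are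
  examined from the right. There K' is negative because eliminating u leaves - R^3 times a positive
  quantity.\<close>

text \<open>The definition speaks of families indexed by an initial segment of the naturals, but the
  families met below are finite sets of pairs or of tagged intervals. A bijection with
  \<open>{..<card A}\<close> transports the estimate.\<close>

lemma absolutely_continuous_onD:
  fixes F :: "real \<Rightarrow> real"
  assumes F: "absolutely_continuous_on S F" and "0 < e"
  obtains d where "0 < d"
    "\<And>(A::'i set) lo hi. finite A \<Longrightarrow> (\<And>i. i \<in> A \<Longrightarrow> lo i \<le> hi i \<and> {lo i..hi i} \<subseteq> S) \<Longrightarrow>
        disjoint_family_on (\<lambda>i. {lo i<..<hi i}) A \<Longrightarrow> (\<Sum>i\<in>A. hi i - lo i) < d \<Longrightarrow>
        (\<Sum>i\<in>A. \<bar>F (hi i) - F (lo i)\<bar>) < e"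
proof -
  from F \<open>0 < e\<close> obtain d where d: "0 < d" and
    *: "\<And>(n::nat) a b. (\<forall>i<n. a i \<le> b i \<and> {a i..b i} \<subseteq> S) \<Longrightarrow>
        disjoint_family_on (\<lambda>i. {a i<..<b i}) {..<n} \<Longrightarrow> (\<Sum>i<n. b i - a i) < d \<Longrightarrow>
        (\<Sum>i<n. \<bar>F (b i) - F (a i)\<bar>) < e"
    unfolding absolutely_continuous_on_def by meson
  show thesis
  proof (rule that[OF d])
    fix A :: "'i set" and lo hi :: "'i \<Rightarrow> real"
    assume A: "finite A" "\<And>i. i \<in> A \<Longrightarrow> lo i \<le> hi i \<and> {lo i..hi i} \<subseteq> S"
      "disjoint_family_on (\<lambda>i. {lo i<..<hi i}) A" "(\<Sum>i\<in>A. hi i - lo i) < d"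
    obtain h where h: "bij_betw h {..<card A} A"
      using ex_bij_betw_nat_finite[OF A(1)] by (auto simp: atLeast0LessThan)
    have hA: "h i \<in> A" if "i < card A" for i
      using h that by (auto simp: bij_betw_def)
    have hne: "h i \<noteq> h j" if "i < card A" "j < card A" "i \<noteq> j" for i j
      using h that by (auto simp: bij_betw_def inj_on_def)
    have "(\<Sum>i<card A. \<bar>F (hi (h i)) - F (lo (h i))\<bar>) < e"
    proof (rule *)
      show "\<forall>i<card A. lo (h i) \<le> hi (h i) \<and> {lo (h i)..hi (h i)} \<subseteq> S"
        using A(2) hA by blast
      show "disjoint_family_on (\<lambda>i. {lo (h i)<..<hi (h i)}) {..<card A}"
        using A(3) hA hne unfolding disjoint_family_on_def by simp
      show "(\<Sum>i<card A. hi (h i) - lo (h i)) < d"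
        using A(4) sum.reindex_bij_betw[OF h, of "\<lambda>i. hi i - lo i"] by simp
    qed
    then show "(\<Sum>i\<in>A. \<bar>F (hi i) - F (lo i)\<bar>) < e"
      using sum.reindex_bij_betw[OF h, of "\<lambda>i. \<bar>F (hi i) - F (lo i)\<bar>"] by simp
  qed
qed

text \<open>The common source of absolute continuity below: for \<open>\<theta>\<close> from
  \<open>p\<close>, for the varied paths and \<open>rate\<close> from \<open>\<theta>\<close>, and
  with \<open>A = 0\<close> for Lipschitz functions.\<close>

lemma absolutely_continuous_on_dominated:
  fixes F G :: "real \<Rightarrow> real"
  assumes F: "absolutely_continuous_on S F"
    and G: "\<And>x y. x \<in> S \<Longrightarrow> y \<in> S \<Longrightarrow> \<bar>G y - G x\<bar> \<le> A * \<bar>F y - F x\<bar> + B * \<bar>y - x\<bar>"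
  shows "absolutely_continuous_on S G"
  unfolding absolutely_continuous_on_def
proof (intro allI impI)
  fix e :: real assume e: "0 < e"
  \<comment> \<open>\<open>A\<close> and \<open>B\<close> may be zero or negative; the maximum with
    1 makes them safe to divide by.\<close>
  define A' B' where "A' = max A 1" and "B' = max B 1"
  have pos: "0 < A'" "0 < B'" by (auto simp: A'_def B'_def)
  have "0 < e / (2 * A')" using e pos by simp
  with F obtain d where d: "0 < d" and
    *: "\<And>(n::nat) a b. (\<forall>i<n. a i \<le> b i \<and> {a i..b i} \<subseteq> S) \<Longrightarrow>
        disjoint_family_on (\<lambda>i. {a i<..<b i}) {..<n} \<Longrightarrow> (\<Sum>i<n. b i - a i) < d \<Longrightarrow>
        (\<Sum>i<n. \<bar>F (b i) - F (a i)\<bar>) < e / (2 * A')"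
    unfolding absolutely_continuous_on_def by meson
  show "\<exists>d>0. \<forall>(n::nat) a b. (\<forall>i<n. a i \<le> b i \<and> {a i..b i} \<subseteq> S) \<longrightarrow>
        disjoint_family_on (\<lambda>i. {a i<..<b i}) {..<n} \<longrightarrow> (\<Sum>i<n. b i - a i) < d \<longrightarrow>
        (\<Sum>i<n. \<bar>G (b i) - G (a i)\<bar>) < e"
  proof (intro exI[of _ "min d (e / (2 * B'))"] conjI allI impI)
    show "0 < min d (e / (2 * B'))" using d e pos by simp
    fix n :: nat and a b :: "nat \<Rightarrow> real"
    assume ab: "\<forall>i<n. a i \<le> b i \<and> {a i..b i} \<subseteq> S"
      and dis: "disjoint_family_on (\<lambda>i. {a i<..<b i}) {..<n}"
      and len: "(\<Sum>i<n. b i - a i) < min d (e / (2 * B'))"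
    have "(\<Sum>i<n. \<bar>G (b i) - G (a i)\<bar>) \<le> (\<Sum>i<n. A' * \<bar>F (b i) - F (a i)\<bar> + B' * (b i - a i))"
    proof (rule sum_mono)
      fix i assume i: "i \<in> {..<n}"
      with ab have ai: "a i \<le> b i" and "{a i..b i} \<subseteq> S" by auto
      then have "a i \<in> S" "b i \<in> S" by auto
      from G[OF this] have "\<bar>G (b i) - G (a i)\<bar> \<le> A * \<bar>F (b i) - F (a i)\<bar> + B * \<bar>b i - a i\<bar>" .
      also have "\<dots> \<le> A' * \<bar>F (b i) - F (a i)\<bar> + B' * (b i - a i)"
        using ai by (intro add_mono mult_mono) (auto simp: A'_def B'_def)
      finally show "\<bar>G (b i) - G (a i)\<bar> \<le> A' * \<bar>F (b i) - F (a i)\<bar> + B' * (b i - a i)" .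
    qed
    also have "\<dots> = A' * (\<Sum>i<n. \<bar>F (b i) - F (a i)\<bar>) + B' * (\<Sum>i<n. b i - a i)"
      by (simp add: sum.distrib sum_distrib_left)
    also have "\<dots> < A' * (e / (2 * A')) + B' * (e / (2 * B'))"
      using *[OF ab dis] len pos by (intro add_strict_mono mult_strict_left_mono) auto
    also have "\<dots> = e" using pos by (simp add: field_simps)
    finally show "(\<Sum>i<n. \<bar>G (b i) - G (a i)\<bar>) < e" .
  qed
qed

lemma lipschitz_imp_absolutely_continuous_on:
  fixes F :: "real \<Rightarrow> real"
  assumes "\<And>x y. x \<in> S \<Longrightarrow> y \<in> S \<Longrightarrow> \<bar>F y - F x\<bar> \<le> B * \<bar>y - x\<bar>"
  shows "absolutely_continuous_on S F"
proof (rule absolutely_continuous_on_dominated[where A = 0 and B = B])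
  show "absolutely_continuous_on S (\<lambda>x. 0::real)"
    unfolding absolutely_continuous_on_def by (auto intro: exI[of _ 1])
qed (use assms in simp)

lemma absolutely_continuous_on_imp_continuous_on:
  fixes F :: "real \<Rightarrow> real"
  assumes F: "absolutely_continuous_on {a..b} F"
  shows "continuous_on {a..b} F"
  unfolding continuous_on_iff
proof (intro ballI allI impI)
  fix x e :: real assume x: "x \<in> {a..b}" and e: "0 < e"
  obtain d where d: "0 < d" and
    *: "\<And>(A::unit set) lo hi. finite A \<Longrightarrow> (\<And>i. i \<in> A \<Longrightarrow> lo i \<le> hi i \<and> {lo i..hi i} \<subseteq> {a..b}) \<Longrightarrow>
        disjoint_family_on (\<lambda>i. {lo i<..<hi i}) A \<Longrightarrow> (\<Sum>i\<in>A. hi i - lo i) < d \<Longrightarrow>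
        (\<Sum>i\<in>A. \<bar>F (hi i) - F (lo i)\<bar>) < e"
    by (rule absolutely_continuous_onD[OF F e, where 'i = unit]) blast
  show "\<exists>d>0. \<forall>y\<in>{a..b}. dist y x < d \<longrightarrow> dist (F y) (F x) < e"
  proof (intro exI[of _ d] conjI ballI impI d)
    fix y assume y: "y \<in> {a..b}" "dist y x < d"
    \<comment> \<open>Taking \<open>min\<close> and \<open>max\<close> as end points treats both
      orders of \<open>x\<close> and \<open>y\<close> with a single interval.\<close>
    have "(\<Sum>i\<in>{()}. \<bar>F (max x y) - F (min x y)\<bar>) < e"
      by (rule *) (use x y in \<open>auto simp: dist_real_def disjoint_family_on_def\<close>)
    then show "dist (F y) (F x) < e"
      by (auto simp: dist_real_def max_def min_def split: if_splits)
  qed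
qed

section \<open>Finite Vitali coverings by intervals, and the gaps they leave\<close>

lemma sum_length_le_measure:
  fixes D :: "(real \<times> real) set"
  assumes "finite D" and D: "\<And>y z. (y, z) \<in> D \<Longrightarrow> y \<le> z \<and> {y..z} \<subseteq> T"
    and dis: "disjoint_family_on (\<lambda>(y, z). {y..z}) D" and T: "T \<in> lmeasurable"
  shows "(\<Sum>(y, z)\<in>D. z - y) = measure lebesgue (\<Union>(y, z)\<in>D. {y..z})"
    and "(\<Sum>(y, z)\<in>D. z - y) \<le> measure lebesgue T"
proof -
  have "measure lebesgue (\<Union>i\<in>D. case i of (y, z) \<Rightarrow> {y..z}) = (\<Sum>i\<in>D. measure lebesgue (case i of (y, z) \<Rightarrow> {y..z}))"
    using dis by (intro measure_UNION' \<open>finite D\<close>)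
      (auto simp: pairwise_def disjoint_family_on_def disjnt_def)
  also have "\<dots> = (\<Sum>(y, z)\<in>D. z - y)"
    using D by (intro sum.cong) auto
  finally show eq: "(\<Sum>(y, z)\<in>D. z - y) = measure lebesgue (\<Union>(y, z)\<in>D. {y..z})" by simp
  show "(\<Sum>(y, z)\<in>D. z - y) \<le> measure lebesgue T"
    unfolding eq using D \<open>finite D\<close> T by (intro measure_mono_fmeasurable) auto
qed

text \<open>The covering theorem for balls leaves a null set after countably many disjoint
  intervals. As \<open>S\<close> has finite measure, continuity of the measure from above lets a
  finite subfamily leave less than \<open>e\<close>. The predicate \<open>P\<close> carries along
  whatever is known of the covering intervals.\<close>

lemma Vitali_finite_intervals:
  fixes S :: "real set"
  assumes S: "S \<in> lmeasurable" and "0 < e"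
    and cov: "\<And>x d. x \<in> S \<Longrightarrow> 0 < d \<Longrightarrow> \<exists>y z. P y z \<and> y < z \<and> y \<le> x \<and> x \<le> z \<and> z - y < d"
  obtains D where "finite D" "\<And>y z. (y, z) \<in> D \<Longrightarrow> P y z \<and> y < z"
    "disjoint_family_on (\<lambda>(y, z). {y..z}) D" "measure lebesgue (S - (\<Union>(y, z)\<in>D. {y..z})) < e"
proof -
  define K where "K = {(y, z). P y z \<and> y < z}"
  \<comment> \<open>An interval is the closed ball about its midpoint with half its length as
    radius.\<close>
  let ?a = "\<lambda>(y::real, z). (y + z) / 2" and ?r = "\<lambda>(y::real, z). (z - y) / 2"
  have cb: "cball (?a i) (?r i) = (case i of (y, z) \<Rightarrow> {y..z})" for i
    by (cases i) (auto simp: cball_eq_atLeastAtMost field_simps)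
  obtain C where C: "countable C" "C \<subseteq> K"
      "pairwise (\<lambda>i j. disjnt (cball (?a i) (?r i)) (cball (?a j) (?r j))) C"
      "negligible (S - (\<Union>i\<in>C. cball (?a i) (?r i)))"
  proof (rule Vitali_covering_theorem_cballs[of K ?r S ?a])
    show "0 < ?r i" if "i \<in> K" for i using that by (auto simp: K_def)
    show "\<exists>i. i \<in> K \<and> x \<in> cball (?a i) (?r i) \<and> ?r i < d" if x: "x \<in> S" "0 < d" for x d
    proof -
      obtain y z where "P y z" "y < z" "y \<le> x" "x \<le> z" "z - y < d"
        using cov[OF x] by blast
      then show ?thesis unfolding cb by (intro exI[of _ "(y, z)"]) (auto simp: K_def)
    qed
  qed blast
  let ?I = "\<lambda>i::real \<times> real. case i of (y, z) \<Rightarrow> {y..z}"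
  note C = C[unfolded cb]
  show thesis
  proof (cases "C = {}")
    case True
    then have "measure lebesgue S = 0" using C(4) by (auto simp: negligible_imp_measure0)
    then show thesis using \<open>0 < e\<close> by (intro that[of "{}"]) (auto simp: disjoint_family_on_def)
  next
    case False
    \<comment> \<open>For finite \<open>C\<close> this enumeration repeats elements, which is
      harmless because only the images of initial segments are used.\<close>
    define f where "f = from_nat_into C"
    have ran: "range f = C" using C(1) False by (simp add: f_def range_from_nat_into)
    define U where "U n = S - (\<Union>i\<in>f ` {..<n}. ?I i)" for n
    have meas: "U n \<in> lmeasurable" for n
      unfolding U_def using S
      by (intro fmeasurable_Diff) (auto intro!: sets.finite_UN split: prod.splits)
    have "(\<lambda>n. measure lebesgue (U n)) \<longlonglongrightarrow> measure lebesgue (\<Inter>n. U n)"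
    proof (rule Lim_measure_decseq)
      show "range U \<subseteq> sets lebesgue" using meas by auto
      show "decseq U"
        unfolding decseq_def U_def by (intro allI impI Diff_mono order_refl UN_mono image_mono) auto
      show "emeasure lebesgue (U i) \<noteq> \<infinity>" for i
        using fmeasurableD2[OF meas[of i]] by (metis infinity_ennreal_def)
    qed
    moreover have "(\<Inter>n. U n) = S - (\<Union>i\<in>C. ?I i)"
    proof -
      have "C = (\<Union>n. f ` {..<n})"
        unfolding ran[symmetric] by blast
      then have "(\<Union>i\<in>C. ?I i) = (\<Union>n. \<Union>i\<in>f ` {..<n}. ?I i)" by simp
      then show ?thesis unfolding U_def by auto
    qed
    ultimately have "(\<lambda>n. measure lebesgue (U n)) \<longlonglongrightarrow> 0"
      using C(4) by (simp add: negligible_imp_measure0)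
    then have "\<forall>\<^sub>F n in sequentially. measure lebesgue (U n) < e"
      using \<open>0 < e\<close> by (rule order_tendstoD)
    then obtain n where n: "measure lebesgue (U n) < e"
      by (meson eventually_happens trivial_limit_sequentially)
    have sub: "f ` {..<n} \<subseteq> C" using ran by auto
    show thesis
    proof (rule that)
      show "finite (f ` {..<n})" by simp
      show "P y z \<and> y < z" if "(y, z) \<in> f ` {..<n}" for y z
        using that sub C(2) by (auto simp: K_def)
      show "disjoint_family_on ?I (f ` {..<n})"
        using C(3) sub unfolding disjoint_family_on_def pairwise_def disjnt_def by blast
      show "measure lebesgue (S - (\<Union>i\<in>f ` {..<n}. ?I i)) < e"
        using n unfolding U_def .
    qed
  qed
qed

lemma disjoint_family_on_Un:
  assumes "disjoint_family_on f A" "disjoint_family_on f B"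
    and "\<And>i j. i \<in> A \<Longrightarrow> j \<in> B \<Longrightarrow> f i \<inter> f j = {}"
  shows "disjoint_family_on f (A \<union> B)"
  using assms unfolding disjoint_family_on_def by (metis Int_commute UnE)

text \<open>Remove one interval of \<open>D\<close> and treat what lies to its left and to its right
  by induction. The telescoping identity is quantified over \<open>F\<close> inside the existential,
  so that one \<open>G\<close> serves for the increments of \<open>F\<close> and, with the identity
  function, for lengths.\<close>

lemma gap_decomposition:
  fixes a b :: real
  assumes "finite D" "a \<le> b" "\<And>y z. (y, z) \<in> D \<Longrightarrow> y < z \<and> {y..z} \<subseteq> {a..b}"
    "disjoint_family_on (\<lambda>(y, z). {y..z}) D"
  shows "\<exists>G. finite G \<and> (\<forall>(y, z)\<in>G. y \<le> z \<and> {y..z} \<subseteq> {a..b}) \<and>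
           disjoint_family_on (\<lambda>(y, z). {y<..<z}) G \<and>
           (\<forall>F::real \<Rightarrow> real. (\<Sum>(y, z)\<in>D. F z - F y) + (\<Sum>(y, z)\<in>G. F z - F y) = F b - F a)"
  using assms
proof (induction "card D" arbitrary: a b D rule: less_induct)
  case less
  show ?case
  proof (cases "D = {}")
    case True
    then show ?thesis using less.prems(2)
      by (intro exI[of _ "{(a, b)}"]) (auto simp: disjoint_family_on_def)
  next
    case False
    then obtain y z where yz: "(y, z) \<in> D" by auto
    define D1 D2 where "D1 = {(r, s). (r, s) \<in> D \<and> s < y}" and "D2 = {(r, s). (r, s) \<in> D \<and> z < r}"
    have yz': "y < z" "a \<le> y" "z \<le> b" using less.prems(3)[OF yz] by auto
    have side: "s < y \<or> z < r" if "(r, s) \<in> D" "(r, s) \<noteq> (y, z)" for r s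
    proof -
      have "{r..s} \<inter> {y..z} = {}"
        using less.prems(4) yz that unfolding disjoint_family_on_def by fastforce
      moreover have "r < s" using less.prems(3)[OF that(1)] by auto
      ultimately show ?thesis using yz' by auto
    qed
    have D: "D = {(y, z)} \<union> D1 \<union> D2" using side yz by (auto simp: D1_def D2_def)
    have fin: "finite D1" "finite D2" using less.prems(1) by (auto simp: D intro: finite_subset)
    have dj: "(y, z) \<notin> D1" "(y, z) \<notin> D2" "D1 \<inter> D2 = {}"
      using yz' by (auto simp: D1_def D2_def dest!: less.prems(3))
    have sub: "D1 \<subseteq> D" "D2 \<subseteq> D" by (auto simp: D)
    have card: "card D1 < card D" "card D2 < card D"
      using sub dj(1,2) yz by (auto intro!: psubset_card_mono less.prems(1))
    have "\<exists>G. finite G \<and> (\<forall>(r, s)\<in>G. r \<le> s \<and> {r..s} \<subseteq> {a..y}) \<and>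
           disjoint_family_on (\<lambda>(y, z). {y<..<z}) G \<and>
           (\<forall>F::real \<Rightarrow> real. (\<Sum>(y, z)\<in>D1. F z - F y) + (\<Sum>(y, z)\<in>G. F z - F y) = F y - F a)"
    proof (rule less.hyps[OF card(1) fin(1) yz'(2)])
      show "r < s \<and> {r..s} \<subseteq> {a..y}" if "(r, s) \<in> D1" for r s
        using less.prems(3)[of r s] that by (auto simp: D1_def)
      show "disjoint_family_on (\<lambda>(y, z). {y..z}) D1"
        by (rule disjoint_family_on_mono[OF sub(1) less.prems(4)])
    qed
    then obtain G1 where G1: "finite G1" "\<forall>(r, s)\<in>G1. r \<le> s \<and> {r..s} \<subseteq> {a..y}"
      "disjoint_family_on (\<lambda>(y, z). {y<..<z}) G1"
      "\<forall>F::real \<Rightarrow> real. (\<Sum>(y, z)\<in>D1. F z - F y) + (\<Sum>(y, z)\<in>G1. F z - F y) = F y - F a"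
      by blast
    have "\<exists>G. finite G \<and> (\<forall>(r, s)\<in>G. r \<le> s \<and> {r..s} \<subseteq> {z..b}) \<and>
           disjoint_family_on (\<lambda>(y, z). {y<..<z}) G \<and>
           (\<forall>F::real \<Rightarrow> real. (\<Sum>(y, z)\<in>D2. F z - F y) + (\<Sum>(y, z)\<in>G. F z - F y) = F b - F z)"
    proof (rule less.hyps[OF card(2) fin(2) yz'(3)])
      show "r < s \<and> {r..s} \<subseteq> {z..b}" if "(r, s) \<in> D2" for r s
        using less.prems(3)[of r s] that by (auto simp: D2_def)
      show "disjoint_family_on (\<lambda>(y, z). {y..z}) D2"
        by (rule disjoint_family_on_mono[OF sub(2) less.prems(4)])
    qed
    then obtain G2 where G2: "finite G2" "\<forall>(r, s)\<in>G2. r \<le> s \<and> {r..s} \<subseteq> {z..b}"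
      "disjoint_family_on (\<lambda>(y, z). {y<..<z}) G2"
      "\<forall>F::real \<Rightarrow> real. (\<Sum>(y, z)\<in>D2. F z - F y) + (\<Sum>(y, z)\<in>G2. F z - F y) = F b - F z"
      by blast
    have G1': "r \<le> s \<and> a \<le> r \<and> s \<le> y" if "(r, s) \<in> G1" for r s
      using bspec[OF G1(2) that] by auto
    have G2': "r \<le> s \<and> z \<le> r \<and> s \<le> b" if "(r, s) \<in> G2" for r s
      using bspec[OF G2(2) that] by auto
    have G12: "G1 \<inter> G2 = {}"
    proof -
      have False if "(r, s) \<in> G1" "(r, s) \<in> G2" for r s
        using G1'[OF that(1)] G2'[OF that(2)] yz' by linarith
      then show ?thesis by auto
    qed
    show ?thesis
    proof (intro exI[of _ "G1 \<union> G2"] conjI)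
      show "finite (G1 \<union> G2)" using G1 G2 by simp
      show "\<forall>(r, s)\<in>G1 \<union> G2. r \<le> s \<and> {r..s} \<subseteq> {a..b}"
      proof -
        have "r \<le> s \<and> a \<le> r \<and> s \<le> b" if "(r, s) \<in> G1 \<union> G2" for r s
          using that yz' by (auto dest!: G1' G2')
        then show ?thesis by auto
      qed
      have cross: "{r<..<s} \<inter> {r'<..<s'} = {}" if "(r, s) \<in> G1" "(r', s') \<in> G2" for r s r' s'
        using G1'[OF that(1)] G2'[OF that(2)] yz' by auto
      have "(case m of (y, z) \<Rightarrow> {y<..<z}) \<inter> (case n of (y, z) \<Rightarrow> {y<..<z}) = {}"
        if "m \<in> G1" "n \<in> G2" for m n using that cross by (cases m; cases n) simp
      with G1(3) G2(3) show "disjoint_family_on (\<lambda>(y, z). {y<..<z}) (G1 \<union> G2)"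
        by (rule disjoint_family_on_Un)
      show "\<forall>F::real \<Rightarrow> real. (\<Sum>(y, z)\<in>D. F z - F y) + (\<Sum>(y, z)\<in>G1 \<union> G2. F z - F y) = F b - F a"
      proof
        fix F :: "real \<Rightarrow> real"
        have "(\<Sum>(y, z)\<in>D. F z - F y) = (F z - F y) + (\<Sum>(y, z)\<in>D1. F z - F y) + (\<Sum>(y, z)\<in>D2. F z - F y)"
          unfolding D using fin dj by (simp add: sum.union_disjoint)
        moreover have "(\<Sum>(y, z)\<in>G1 \<union> G2. F z - F y) = (\<Sum>(y, z)\<in>G1. F z - F y) + (\<Sum>(y, z)\<in>G2. F z - F y)"
          using G1(1) G2(1) G12 by (simp add: sum.union_disjoint)
        ultimately show "(\<Sum>(y, z)\<in>D. F z - F y) + (\<Sum>(y, z)\<in>G1 \<union> G2. F z - F y) = F b - F a"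
          using G1(4)[rule_format, of F] G2(4)[rule_format, of F] by simp
      qed
    qed
  qed
qed

section \<open>Points of large upper or small lower derivate\<close>

text \<open>The points at which the upper derivate of \<open>F\<close> (along intervals shrinking to the point)
  is, up to the borderline case, at least \<open>s\<close>; \<open>steep_points a b (\<lambda>x. - F x) (- r)\<close> does the same
  for the lower derivate and \<open>\<le> r\<close>.\<close>

definition steep_points :: "real \<Rightarrow> real \<Rightarrow> (real \<Rightarrow> real) \<Rightarrow> real \<Rightarrow> real set" where
  "steep_points a b F s =
     {x. \<forall>d>0. \<exists>y z. y < x \<and> x < z \<and> {y..z} \<subseteq> {a..b} \<and> z - y < d \<and> s * (z - y) < F z - F y}"

lemma steep_points_subset: "steep_points a b F s \<subseteq> {a..b}"
  unfolding steep_points_def by (force intro: zero_less_one)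

text \<open>Since the point lies strictly between the end points, the intervals may be taken open;
  letting the length bound run through \<open>inverse (real (Suc n))\<close> makes the set a
  countable intersection of open sets, whatever \<open>F\<close> is.\<close>

lemma steep_points_lmeasurable: "steep_points a b F s \<in> lmeasurable"
proof -
  define W where "W n = (\<Union>(y, z)\<in>{(y, z). {y..z} \<subseteq> {a..b} \<and> z - y < inverse (real (Suc n)) \<and> s * (z - y) < F z - F y}. {y<..<z})" for n
  have "steep_points a b F s = (\<Inter>n. W n)"
  proof (intro equalityI subsetI)
    fix x assume x: "x \<in> steep_points a b F s"
    show "x \<in> (\<Inter>n. W n)"
    proof
      fix n
      have "0 < inverse (real (Suc n))" by simp
      with x obtain y z where "y < x" "x < z" "{y..z} \<subseteq> {a..b}" "z - y < inverse (real (Suc n))" "s * (z - y) < F z - F y"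
        unfolding steep_points_def by blast
      then show "x \<in> W n" unfolding W_def by (intro UN_I[of "(y, z)"]) auto
    qed
  next
    fix x assume x: "x \<in> (\<Inter>n. W n)"
    show "x \<in> steep_points a b F s"
      unfolding steep_points_def
    proof (intro CollectI allI impI)
      fix d :: real assume "0 < d"
      then obtain n where n: "inverse (real (Suc n)) < d" using reals_Archimedean by blast
      from x have "x \<in> W n" by auto
      then obtain y z where "y < x" "x < z" "{y..z} \<subseteq> {a..b}" "z - y < inverse (real (Suc n))" "s * (z - y) < F z - F y"
        unfolding W_def by auto
      then show "\<exists>y z. y < x \<and> x < z \<and> {y..z} \<subseteq> {a..b} \<and> z - y < d \<and> s * (z - y) < F z - F y"
        using n by (intro exI[of _ y] exI[of _ z]) auto
    qed
  qed
  moreover have "open (W n)" for n unfolding W_def by (intro open_UN) auto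
  then have "(\<Inter>n. W n) \<in> sets borel" by (intro sets.countable_INT) auto
  ultimately have "steep_points a b F s \<in> sets lebesgue" by simp
  then show ?thesis
    by (intro fmeasurableI2[OF lmeasurable_interval(1)[unfolded box_real] steep_points_subset])
qed

text \<open>By Vitali, disjoint intervals of slope above \<open>s\<close> fill \<open>E\<close>
  inside \<open>[y, z]\<close> up to measure \<open>e\<close>. They take at least \<open>s\<close>
  times their length of the increment of \<open>F\<close>. \<open>G\<close> consists of the gaps
  between them, and the last two estimates say what remains for it.\<close>

lemma steep_gaps:
  assumes E: "E \<in> lmeasurable" "E \<subseteq> steep_points a b F s" and "0 < e" and yz: "y \<le> z"
  obtains G where "finite G" "\<And>p q. (p, q) \<in> G \<Longrightarrow> p \<le> q \<and> {p..q} \<subseteq> {y..z}"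
    "disjoint_family_on (\<lambda>(p, q). {p<..<q}) G"
    "(\<Sum>(p, q)\<in>G. q - p) < z - y - measure lebesgue (E \<inter> {y..z}) + e"
    "(\<Sum>(p, q)\<in>G. F q - F p) \<le> F z - F y - s * (z - y) + s * (\<Sum>(p, q)\<in>G. q - p)"
proof -
  let ?P = "\<lambda>p q. {p..q} \<subseteq> {y..z} \<and> s * (q - p) < F q - F p"
  have meas: "E \<inter> {y<..<z} \<in> lmeasurable" using E(1) by (intro fmeasurable.Int) auto
  obtain D where D: "finite D" "\<And>p q. (p, q) \<in> D \<Longrightarrow> ?P p q \<and> p < q"
    "disjoint_family_on (\<lambda>(y, z). {y..z}) D"
    "measure lebesgue (E \<inter> {y<..<z} - (\<Union>(y, z)\<in>D. {y..z})) < e"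
  proof (rule Vitali_finite_intervals[OF meas \<open>0 < e\<close>, of ?P])
    fix x d :: real assume x: "x \<in> E \<inter> {y<..<z}" and d: "0 < d"
    \<comment> \<open>Staying below the distance of \<open>x\<close> to both end points keeps the
      interval inside \<open>[y, z]\<close>.\<close>
    define d' where "d' = min d (min (x - y) (z - x))"
    have "0 < d'" using x d by (auto simp: d'_def)
    then obtain p q where pq: "p < x" "x < q" "q - p < d'" "s * (q - p) < F q - F p"
      using x E(2) unfolding steep_points_def by blast
    then show "\<exists>p q. ?P p q \<and> p < q \<and> p \<le> x \<and> x \<le> q \<and> q - p < d"
      by (intro exI[of _ p] exI[of _ q]) (auto simp: d'_def)
  qed blast
  have D': "p < q \<and> {p..q} \<subseteq> {y..z}" if "(p, q) \<in> D" for p q using D(2)[OF that] by auto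
  obtain G where G: "finite G" "\<forall>(p, q)\<in>G. p \<le> q \<and> {p..q} \<subseteq> {y..z}"
     "disjoint_family_on (\<lambda>(y, z). {y<..<z}) G"
     "\<And>F::real \<Rightarrow> real. (\<Sum>(y, z)\<in>D. F z - F y) + (\<Sum>(y, z)\<in>G. F z - F y) = F z - F y"
    using gap_decomposition[OF D(1) yz D' D(3)] by blast
  have len: "(\<Sum>(p, q)\<in>D. q - p) + (\<Sum>(p, q)\<in>G. q - p) = z - y" using G(4)[of "\<lambda>x. x"] .
  have lenD: "(\<Sum>(p, q)\<in>D. q - p) = measure lebesgue (\<Union>(p, q)\<in>D. {p..q})"
    using D' D(1,3) by (intro sum_length_le_measure[where T = "{y..z}"]) (auto intro: less_imp_le)
  let ?V = "\<Union>(p, q)\<in>D. {p..q}"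
  have V: "?V \<in> lmeasurable" using D(1) by (intro fmeasurable.finite_UN) auto
  have "negligible ((E \<inter> {y<..<z} - E \<inter> {y..z}) \<union> (E \<inter> {y..z} - E \<inter> {y<..<z}))"
    by (rule negligible_subset[of "{y, z}"]) auto
  then have "measure lebesgue (E \<inter> {y..z}) = measure lebesgue (E \<inter> {y<..<z})"
    using meas by (intro measure_negligible_symdiff) auto
  also have "\<dots> \<le> measure lebesgue ((E \<inter> {y<..<z} - ?V) \<union> ?V)"
    using meas V by (intro measure_mono_fmeasurable) (auto intro!: fmeasurable.Un fmeasurable_Diff)
  also have "\<dots> \<le> measure lebesgue (E \<inter> {y<..<z} - ?V) + measure lebesgue ?V"
    using meas V by (intro measure_Un_le) auto
  also have "\<dots> < e + (\<Sum>(p, q)\<in>D. q - p)" using D(4) lenD by simp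
  finally have 1: "measure lebesgue (E \<inter> {y..z}) < e + (\<Sum>(p, q)\<in>D. q - p)" .
  have "s * (\<Sum>(p, q)\<in>D. q - p) \<le> (\<Sum>(p, q)\<in>D. F q - F p)"
    unfolding sum_distrib_left using D(2) by (intro sum_mono) (fastforce intro: less_imp_le)
  moreover have "(\<Sum>(p, q)\<in>D. q - p) = z - y - (\<Sum>(p, q)\<in>G. q - p)" using len by simp
  ultimately have 2: "s * (z - y) - s * (\<Sum>(p, q)\<in>G. q - p) \<le> (\<Sum>(p, q)\<in>D. F q - F p)"
    by (simp add: right_diff_distrib)
  show thesis
  proof (rule that[OF G(1)])
    show "p \<le> q \<and> {p..q} \<subseteq> {y..z}" if "(p, q) \<in> G" for p q using G(2) that by fast
    show "disjoint_family_on (\<lambda>(p, q). {p<..<q}) G" by (rule G(3))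
    show "(\<Sum>(p, q)\<in>G. q - p) < z - y - measure lebesgue (E \<inter> {y..z}) + e"
      using 1 len by linarith
    show "(\<Sum>(p, q)\<in>G. F q - F p) \<le> F z - F y - s * (z - y) + s * (\<Sum>(p, q)\<in>G. q - p)"
      using 2 G(4)[of F] by linarith
  qed
qed

text \<open>Cover almost all of the exceptional set \<open>E\<close> by disjoint intervals of slope \<open>< r\<close> that fill
  little more than \<open>E\<close>, and almost all of \<open>E\<close> inside them by intervals of slope \<open>> s\<close>. The gaps
  have tiny total length, yet \<open>F\<close> must drop over them by about \<open>(s - r) |E|\<close>, which absolute
  continuity forbids.\<close>

lemma negligible_derivates_gap:
  fixes F :: "real \<Rightarrow> real"
  assumes F: "absolutely_continuous_on {a..b} F" and rs: "r < s"
  shows "negligible (steep_points a b F s \<inter> steep_points a b (\<lambda>x. - F x) (- r))"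
proof (rule ccontr)
  define E where "E = steep_points a b F s \<inter> steep_points a b (\<lambda>x. - F x) (- r)"
  assume "\<not> negligible (steep_points a b F s \<inter> steep_points a b (\<lambda>x. - F x) (- r))"
  moreover have E: "E \<in> lmeasurable"
    unfolding E_def by (intro fmeasurable.Int steep_points_lmeasurable)
  ultimately have "measure lebesgue E \<noteq> 0"
    using negligible_iff_measure0[OF E] by (auto simp: E_def)
  then have pos: "0 < measure lebesgue E" by (simp add: zero_less_measure_iff)
  define \<alpha> where "\<alpha> = measure lebesgue E"
  \<comment> \<open>The drop over the gaps will be at least \<open>(s - r) * \<alpha> / 2\<close>,
    that is \<open>2 * \<epsilon>\<close>, less an error of at most
    \<open>\<epsilon>\<close>.\<close>
  define \<epsilon> where "\<epsilon> = (s - r) * \<alpha> / 4"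
  have \<epsilon>: "0 < \<epsilon>" using rs pos by (simp add: \<epsilon>_def \<alpha>_def)
  obtain d where d: "0 < d" and
    ac: "\<And>(A::((real \<times> real) \<times> (real \<times> real)) set) lo hi. finite A \<Longrightarrow>
        (\<And>i. i \<in> A \<Longrightarrow> lo i \<le> hi i \<and> {lo i..hi i} \<subseteq> {a..b}) \<Longrightarrow>
        disjoint_family_on (\<lambda>i. {lo i<..<hi i}) A \<Longrightarrow> (\<Sum>i\<in>A. hi i - lo i) < d \<Longrightarrow>
        (\<Sum>i\<in>A. \<bar>F (hi i) - F (lo i)\<bar>) < \<epsilon>"
    by (rule absolutely_continuous_onD[OF F \<epsilon>]) blast
  \<comment> \<open>Up to \<open>\<eta>\<close> is lost in each of three places: \<open>T\<close>
    outside \<open>E\<close>, the part of \<open>E\<close> missed by the outer intervals, and all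
    inner coverings together. So the gaps have total length below \<open>3 * \<eta>\<close>, which
    must stay within \<open>d\<close> and, weighted by \<open>\<bar>s\<bar>\<close>, within
    \<open>\<epsilon>\<close>. The bound \<open>\<alpha> / 2\<close> keeps the outer length above
    half of \<open>\<alpha>\<close>.\<close>
  define \<eta> where "\<eta> = min (d / 3) (min (\<alpha> / 2) (\<epsilon> / (3 * (\<bar>s\<bar> + 1))))"
  have "\<eta> \<le> d / 3" "\<eta> \<le> \<alpha> / 2" "\<eta> \<le> \<epsilon> / (3 * (\<bar>s\<bar> + 1))"
    unfolding \<eta>_def by (simp_all only: min.cobounded1 min.coboundedI2 min.cobounded2)
  moreover have "0 < \<eta>" using d pos \<epsilon> by (auto simp: \<eta>_def \<alpha>_def)
  ultimately have \<eta>: "0 < \<eta>" "3 * \<eta> \<le> d" "\<eta> \<le> \<alpha> / 2" by linarith+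
  from \<open>\<eta> \<le> \<epsilon> / (3 * (\<bar>s\<bar> + 1))\<close> have "\<eta> * (3 * (\<bar>s\<bar> + 1)) \<le> \<epsilon>" by (subst (asm) pos_le_divide_eq) auto
  moreover have "\<bar>s\<bar> * (3 * \<eta>) \<le> \<eta> * (3 * (\<bar>s\<bar> + 1))" using \<eta> by (simp add: algebra_simps)
  ultimately have \<eta>s: "\<bar>s\<bar> * (3 * \<eta>) \<le> \<epsilon>" by linarith
  obtain T where T: "open T" "E \<subseteq> T" "T - E \<in> lmeasurable" "emeasure lebesgue (T - E) < ennreal \<eta>"
    using sets_lebesgue_outer_open[of E \<eta>] E \<eta> by auto
  have Tm: "T \<in> lmeasurable" using fmeasurable.Un[OF E T(3)] T(2) by (simp add: Un_absorb1)
  have "measure lebesgue (T - E) < \<eta>"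
    using T(4) \<eta>(1) unfolding emeasure_eq_measure2[OF T(3)] by (simp add: ennreal_less_iff)
  moreover have "measure lebesgue (T - E) = measure lebesgue T - \<alpha>"
    unfolding \<alpha>_def using Tm E T(2) by (intro measurable_measure_Diff) auto
  ultimately have T': "measure lebesgue T < \<alpha> + \<eta>" by simp
  let ?P = "\<lambda>y z. {y..z} \<subseteq> T \<inter> {a..b} \<and> F z - F y < r * (z - y)"
  obtain D where D: "finite D" "\<And>y z. (y, z) \<in> D \<Longrightarrow> ?P y z \<and> y < z"
    "disjoint_family_on (\<lambda>(y, z). {y..z}) D"
    "measure lebesgue (E - (\<Union>(y, z)\<in>D. {y..z})) < \<eta>"
  proof (rule Vitali_finite_intervals[OF E \<eta>(1), of ?P])
    fix x e :: real assume x: "x \<in> E" and e: "0 < e"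
    obtain e' where e': "0 < e'" "ball x e' \<subseteq> T" using T(1,2) x by (meson openE subsetD)
    have "0 < min e e'" using e e' by simp
    then obtain y z where yz: "y < x" "x < z" "{y..z} \<subseteq> {a..b}" "z - y < min e e'" "- r * (z - y) < - F z - - F y"
      using x unfolding E_def steep_points_def by blast
    moreover have "{y..z} \<subseteq> ball x e'" using yz by (auto simp: dist_real_def)
    ultimately show "\<exists>y z. ?P y z \<and> y < z \<and> y \<le> x \<and> x \<le> z \<and> z - y < e"
      using e'(2) by (intro exI[of _ y] exI[of _ z]) auto
  qed blast
  \<comment> \<open>An equal share of \<open>\<eta>\<close> for each outer interval; the 1 guards
    against an empty \<open>D\<close>.\<close>
  define \<eta>' where "\<eta>' = \<eta> / (real (card D) + 1)"
  have \<eta>': "0 < \<eta>'" using \<eta> by (simp add: \<eta>'_def)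
  have cardD: "real (card D) * \<eta>' \<le> \<eta>" using \<eta> by (simp add: \<eta>'_def field_simps)
  let ?Q = "\<lambda>J G. finite G \<and> (\<forall>(p, q)\<in>G. p \<le> q \<and> {p..q} \<subseteq> {fst J..snd J}) \<and>
      disjoint_family_on (\<lambda>(p, q). {p<..<q}) G \<and>
      (\<Sum>(p, q)\<in>G. q - p) < snd J - fst J - measure lebesgue (E \<inter> {fst J..snd J}) + \<eta>' \<and>
      (\<Sum>(p, q)\<in>G. F q - F p) \<le> F (snd J) - F (fst J) - s * (snd J - fst J) + s * (\<Sum>(p, q)\<in>G. q - p)"
  have "\<forall>J\<in>D. \<exists>G. ?Q J G"
  proof
    fix J assume that: "J \<in> D"
    have yz: "fst J \<le> snd J" using D(2)[of "fst J" "snd J"] that by simp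
    have "E \<subseteq> steep_points a b F s" by (simp add: E_def)
    from steep_gaps[OF E this \<eta>' yz] obtain G where
      "finite G" "\<And>p q. (p, q) \<in> G \<Longrightarrow> p \<le> q \<and> {p..q} \<subseteq> {fst J..snd J}"
      "disjoint_family_on (\<lambda>(p, q). {p<..<q}) G"
      "(\<Sum>(p, q)\<in>G. q - p) < snd J - fst J - measure lebesgue (E \<inter> {fst J..snd J}) + \<eta>'"
      "(\<Sum>(p, q)\<in>G. F q - F p) \<le> F (snd J) - F (fst J) - s * (snd J - fst J) + s * (\<Sum>(p, q)\<in>G. q - p)"
      by blast
    then show "\<exists>G. ?Q J G" by (intro exI[of _ G] conjI) auto
  qed
  from bchoice[OF this] obtain G where Q: "\<forall>J\<in>D. ?Q J (G J)" ..
  note G = bspec[OF Q, THEN conjunct1] bspec[OF Q, THEN conjunct2, THEN conjunct1]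
    bspec[OF Q, THEN conjunct2, THEN conjunct2, THEN conjunct1]
    bspec[OF Q, THEN conjunct2, THEN conjunct2, THEN conjunct2, THEN conjunct1]
    bspec[OF Q, THEN conjunct2, THEN conjunct2, THEN conjunct2, THEN conjunct2]
  \<comment> \<open>Pairing each gap with its outer interval turns the double sum into the single
    sum to which absolute continuity applies.\<close>
  define A where "A = Sigma D G"
  define lo hi :: "(real \<times> real) \<times> (real \<times> real) \<Rightarrow> real"
    where "lo = (\<lambda>i. fst (snd i))" and "hi = (\<lambda>i. snd (snd i))"
  have sumA: "(\<Sum>i\<in>A. f (lo i) (hi i)) = (\<Sum>J\<in>D. \<Sum>(p, q)\<in>G J. f p q)" for f :: "real \<Rightarrow> real \<Rightarrow> real"
    unfolding A_def lo_def hi_def using D(1) G(1) by (subst sum.Sigma) (auto simp: split_def)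
  define L where "L = (\<Sum>J\<in>D. snd J - fst J)"
  have Leq: "L = (\<Sum>(y, z)\<in>D. z - y)" by (simp add: L_def split_def)
  have DI: "y \<le> z \<and> {y..z} \<subseteq> T" if "(y, z) \<in> D" for y z using D(2)[OF that] by auto
  have LT: "L \<le> measure lebesgue T" and LV: "L = measure lebesgue (\<Union>(y, z)\<in>D. {y..z})"
    unfolding Leq using sum_length_le_measure[OF D(1) DI D(3) Tm] by simp_all
  have EJ: "(\<Sum>J\<in>D. measure lebesgue (E \<inter> {fst J..snd J})) = measure lebesgue (E \<inter> (\<Union>(y, z)\<in>D. {y..z}))"
  proof -
    have "measure lebesgue (\<Union>J\<in>D. E \<inter> {fst J..snd J}) = (\<Sum>J\<in>D. measure lebesgue (E \<inter> {fst J..snd J}))"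
    proof (intro measure_UNION' D(1))
      show "pairwise (\<lambda>i j. disjnt (E \<inter> {fst i..snd i}) (E \<inter> {fst j..snd j})) D"
        using D(3) unfolding pairwise_def disjoint_family_on_def disjnt_def split_def by blast
    qed (use E in \<open>auto intro!: fmeasurable.Int\<close>)
    moreover have "(\<Union>J\<in>D. E \<inter> {fst J..snd J}) = E \<inter> (\<Union>(y, z)\<in>D. {y..z})" by (auto simp: split_def)
    ultimately show ?thesis by simp
  qed
  let ?V = "\<Union>(y, z)\<in>D. {y..z}"
  have V: "?V \<in> lmeasurable" using D(1) by (intro fmeasurable.finite_UN) auto
  have "measure lebesgue ((E \<inter> ?V) \<union> (E - ?V)) \<le> measure lebesgue (E \<inter> ?V) + measure lebesgue (E - ?V)"
    using E V by (intro measure_Un_le) auto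
  then have "measure lebesgue E \<le> measure lebesgue (E \<inter> ?V) + measure lebesgue (E - ?V)"
    by (simp add: Un_Diff_Int Int_Diff_Un)
  then have EV: "\<alpha> - \<eta> < measure lebesgue (E \<inter> ?V)" using D(4) by (simp add: \<alpha>_def)
  have "measure lebesgue (E \<inter> ?V) \<le> L"
    unfolding LV using E V by (intro measure_mono_fmeasurable) auto
  with EV have Lge: "\<alpha> - \<eta> < L" by simp
  define \<Lambda> where "\<Lambda> = (\<Sum>i\<in>A. hi i - lo i)"
  have \<Lambda>_eq: "\<Lambda> = (\<Sum>J\<in>D. \<Sum>(p, q)\<in>G J. q - p)" unfolding \<Lambda>_def by (rule sumA)
  also have "\<dots> \<le> (\<Sum>J\<in>D. (snd J - fst J) - measure lebesgue (E \<inter> {fst J..snd J}) + \<eta>')"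
    using G(4) by (intro sum_mono) (auto intro: less_imp_le)
  also have "\<dots> = L - measure lebesgue (E \<inter> ?V) + real (card D) * \<eta>'"
    unfolding EJ[symmetric] L_def by (simp add: sum.distrib sum_subtractf)
  also have "\<dots> < 3 * \<eta>" using LT T' EV cardD by linarith
  finally have \<Lambda>: "\<Lambda> < 3 * \<eta>" .
  have Ai: "lo i \<le> hi i \<and> {lo i..hi i} \<subseteq> {fst (fst i)..snd (fst i)} \<and> fst i \<in> D \<and> snd i \<in> G (fst i)" if "i \<in> A" for i
  proof -
    have i: "fst i \<in> D" "snd i \<in> G (fst i)" using that by (auto simp: A_def)
    with bspec[OF G(2)[OF i(1)] i(2)] show ?thesis by (simp add: lo_def hi_def split_def)
  qed
  have \<Lambda>0: "0 \<le> \<Lambda>" unfolding \<Lambda>_def using Ai by (intro sum_nonneg) auto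
  have "(\<Sum>i\<in>A. \<bar>F (hi i) - F (lo i)\<bar>) < \<epsilon>"
  proof (rule ac)
    show "finite A" unfolding A_def using D(1) G(1) by auto
    show "lo i \<le> hi i \<and> {lo i..hi i} \<subseteq> {a..b}" if "i \<in> A" for i
      using Ai[OF that] D(2)[of "fst (fst i)" "snd (fst i)"] by auto
    show "(\<Sum>i\<in>A. hi i - lo i) < d" using \<Lambda> \<eta> by (simp add: \<Lambda>_def)
    show "disjoint_family_on (\<lambda>i. {lo i<..<hi i}) A"
      unfolding disjoint_family_on_def
    proof (intro ballI impI)
      fix i j assume ij: "i \<in> A" "j \<in> A" "i \<noteq> j"
      show "{lo i<..<hi i} \<inter> {lo j<..<hi j} = {}"
      proof (cases "fst i = fst j")
        case True
        then have "snd i \<noteq> snd j" using ij(3) by (simp add: prod_eq_iff)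
        moreover have "snd i \<in> G (fst i)" "snd j \<in> G (fst i)" using Ai[OF ij(1)] Ai[OF ij(2)] True by auto
        ultimately show ?thesis
          using G(3)[of "fst i"] Ai[OF ij(1)] unfolding disjoint_family_on_def lo_def hi_def split_def by blast
      next
        case False
        then have "{fst (fst i)..snd (fst i)} \<inter> {fst (fst j)..snd (fst j)} = {}"
          using D(3) Ai[OF ij(1)] Ai[OF ij(2)] unfolding disjoint_family_on_def split_def by blast
        moreover have "{lo i<..<hi i} \<subseteq> {lo i..hi i}" "{lo j<..<hi j} \<subseteq> {lo j..hi j}" by auto
        ultimately show ?thesis using Ai[OF ij(1)] Ai[OF ij(2)] by blast
      qed
    qed
  qed
  moreover have "\<bar>\<Sum>i\<in>A. F (hi i) - F (lo i)\<bar> \<le> (\<Sum>i\<in>A. \<bar>F (hi i) - F (lo i)\<bar>)" by (rule sum_abs)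
  ultimately have lower: "- \<epsilon> < (\<Sum>i\<in>A. F (hi i) - F (lo i))" by linarith
  have "(\<Sum>i\<in>A. F (hi i) - F (lo i)) = (\<Sum>J\<in>D. \<Sum>(p, q)\<in>G J. F q - F p)" by (rule sumA)
  also have "\<dots> \<le> (\<Sum>J\<in>D. - (s - r) * (snd J - fst J) + s * (\<Sum>(p, q)\<in>G J. q - p))"
  proof (rule sum_mono)
    fix J assume J: "J \<in> D"
    have "F (snd J) - F (fst J) < r * (snd J - fst J)" using D(2)[of "fst J" "snd J"] J by simp
    with G(5)[OF J] show "(\<Sum>(p, q)\<in>G J. F q - F p) \<le> - (s - r) * (snd J - fst J) + s * (\<Sum>(p, q)\<in>G J. q - p)"
      by (simp add: left_diff_distrib)
  qed
  also have "\<dots> = - (s - r) * L + s * \<Lambda>"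
    unfolding \<Lambda>_eq L_def by (simp only: sum.distrib sum_distrib_left)
  also have "\<dots> \<le> - (s - r) * (\<alpha> / 2) + \<bar>s\<bar> * (3 * \<eta>)"
  proof (rule add_mono)
    show "- (s - r) * L \<le> - (s - r) * (\<alpha> / 2)" using rs Lge \<eta>(3) by (intro mult_left_mono_neg) auto
    have "s * \<Lambda> \<le> \<bar>s\<bar> * \<Lambda>" using \<Lambda>0 by (intro mult_right_mono) auto
    also have "\<dots> \<le> \<bar>s\<bar> * (3 * \<eta>)" using \<Lambda> by (intro mult_left_mono) auto
    finally show "s * \<Lambda> \<le> \<bar>s\<bar> * (3 * \<eta>)" .
  qed
  also have "\<dots> \<le> - \<epsilon>" using \<eta>s by (simp add: \<epsilon>_def field_simps)
  finally show False using lower by simp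
qed

lemma steep_points_antimono: "r \<le> s \<Longrightarrow> steep_points a b F s \<subseteq> steep_points a b F r"
  unfolding steep_points_def
proof (intro subsetI CollectI allI impI)
  fix x d :: real
  assume rs: "r \<le> s" and x: "x \<in> {x. \<forall>d>0. \<exists>y z. y < x \<and> x < z \<and> {y..z} \<subseteq> {a..b} \<and> z - y < d \<and> s * (z - y) < F z - F y}"
    and d: "0 < d"
  then obtain y z where yz: "y < x" "x < z" "{y..z} \<subseteq> {a..b}" "z - y < d" "s * (z - y) < F z - F y" by blast
  have "r * (z - y) \<le> s * (z - y)" using rs yz by (intro mult_right_mono) auto
  also note yz(5)
  finally show "\<exists>y z. y < x \<and> x < z \<and> {y..z} \<subseteq> {a..b} \<and> z - y < d \<and> r * (z - y) < F z - F y"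
    using yz(1-4) by blast
qed

text \<open>Absolute continuity with tolerance 1 bounds the variation over total length below
  \<open>d\<close>. If a window of width \<open>d / 2\<close> met the set in measure
  \<open>\<beta> > 0\<close>, disjoint intervals of slope above \<open>2 / \<beta>\<close> would
  cover more than half of \<open>\<beta>\<close> there and yield a variation above 1. So the set is
  locally negligible, hence negligible.\<close>

lemma negligible_infinite_derivate:
  fixes F :: "real \<Rightarrow> real"
  assumes F: "absolutely_continuous_on {a..b} F"
  shows "negligible (\<Inter>n::nat. steep_points a b F (real n))"
proof -
  define E where "E = (\<Inter>n::nat. steep_points a b F (real n))"
  have E: "E \<in> lmeasurable"
  proof (rule fmeasurableI2[OF steep_points_lmeasurable])
    show "E \<subseteq> steep_points a b F (real 0)" unfolding E_def by (rule INT_lower) simp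
    show "E \<in> sets lebesgue" unfolding E_def
      by (intro sets.countable_INT) (auto intro: fmeasurableD steep_points_lmeasurable)
  qed
  obtain d where d: "0 < d" and
    ac: "\<And>(A::(real \<times> real) set) lo hi. finite A \<Longrightarrow>
        (\<And>i. i \<in> A \<Longrightarrow> lo i \<le> hi i \<and> {lo i..hi i} \<subseteq> {a..b}) \<Longrightarrow>
        disjoint_family_on (\<lambda>i. {lo i<..<hi i}) A \<Longrightarrow> (\<Sum>i\<in>A. hi i - lo i) < d \<Longrightarrow>
        (\<Sum>i\<in>A. \<bar>F (hi i) - F (lo i)\<bar>) < 1"
    by (rule absolutely_continuous_onD[OF F zero_less_one]) blast
  have "negligible (E \<inter> {x - d / 4<..<x + d / 4})" for x
  proof (rule ccontr)
    define U where "U = E \<inter> {x - d / 4<..<x + d / 4}"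
    define \<beta> where "\<beta> = measure lebesgue U"
    assume "\<not> negligible (E \<inter> {x - d / 4<..<x + d / 4})"
    moreover have U: "U \<in> lmeasurable" unfolding U_def using E by (intro fmeasurable.Int) auto
    ultimately have "\<beta> \<noteq> 0" using negligible_iff_measure0[OF U] by (auto simp: U_def \<beta>_def)
    then have \<beta>: "0 < \<beta>" by (simp add: \<beta>_def zero_less_measure_iff)
    obtain n :: nat where n: "2 / \<beta> < real n" using reals_Archimedean2 by blast
    let ?P = "\<lambda>y z. {y..z} \<subseteq> {a..b} \<inter> {x - d / 4..x + d / 4} \<and> real n * (z - y) < F z - F y"
    have "0 < \<beta> / 2" using \<beta> by simp
    obtain D where D: "finite D" "\<And>y z. (y, z) \<in> D \<Longrightarrow> ?P y z \<and> y < z"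
      "disjoint_family_on (\<lambda>(y, z). {y..z}) D" "measure lebesgue (U - (\<Union>(y, z)\<in>D. {y..z})) < \<beta> / 2"
    proof (rule Vitali_finite_intervals[OF U \<open>0 < \<beta> / 2\<close>, of ?P])
      fix t e :: real assume t: "t \<in> U" and e: "0 < e"
      define e' where "e' = min e (min (t - (x - d / 4)) (x + d / 4 - t))"
      have "0 < e'" using t e by (auto simp: U_def e'_def)
      moreover have "t \<in> steep_points a b F (real n)" using t by (auto simp: U_def E_def)
      ultimately obtain y z where yz: "y < t" "t < z" "{y..z} \<subseteq> {a..b}" "z - y < e'" "real n * (z - y) < F z - F y"
        unfolding steep_points_def by blast
      then show "\<exists>y z. ?P y z \<and> y < z \<and> y \<le> t \<and> t \<le> z \<and> z - y < e"
        by (intro exI[of _ y] exI[of _ z]) (auto simp: e'_def)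
    qed blast
    have DI: "y \<le> z \<and> {y..z} \<subseteq> {x - d / 4..x + d / 4}" if "(y, z) \<in> D" for y z
      using D(2)[OF that] by auto
    let ?V = "\<Union>(y, z)\<in>D. {y..z}"
    have len: "(\<Sum>(y, z)\<in>D. z - y) = measure lebesgue ?V" "(\<Sum>(y, z)\<in>D. z - y) \<le> d / 2"
      using sum_length_le_measure[OF D(1) DI D(3)] d by auto
    have V: "?V \<in> lmeasurable" using D(1) by (intro fmeasurable.finite_UN) auto
    have "\<beta> \<le> measure lebesgue ((U - ?V) \<union> ?V)"
      unfolding \<beta>_def using U V by (intro measure_mono_fmeasurable) (auto intro!: fmeasurable.Un fmeasurable_Diff)
    also have "\<dots> \<le> measure lebesgue (U - ?V) + measure lebesgue ?V"
      using U V by (intro measure_Un_le) auto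
    finally have "\<beta> / 2 < (\<Sum>(y, z)\<in>D. z - y)" using D(4) len(1) by simp
    then have "real n * (\<beta> / 2) \<le> real n * (\<Sum>(y, z)\<in>D. z - y)" by (intro mult_left_mono) auto
    also have "\<dots> = (\<Sum>i\<in>D. real n * (snd i - fst i))" by (simp add: sum_distrib_left split_def)
    also have "\<dots> \<le> (\<Sum>i\<in>D. \<bar>F (snd i) - F (fst i)\<bar>)"
      by (intro sum_mono) (use D(2) in fastforce)
    also have "\<dots> < 1"
    proof (rule ac[OF D(1)])
      show "fst i \<le> snd i \<and> {fst i..snd i} \<subseteq> {a..b}" if "i \<in> D" for i
        using D(2)[of "fst i" "snd i"] that by auto
      have "{fst i<..<snd i} \<subseteq> (case i of (y, z) \<Rightarrow> {y..z})" for i :: "real \<times> real" by (auto simp: split_def)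
      then show "disjoint_family_on (\<lambda>i. {fst i<..<snd i}) D"
        using D(3) unfolding disjoint_family_on_def by blast
      show "(\<Sum>i\<in>D. snd i - fst i) < d" using len(2) d by (simp add: split_def)
    qed
    finally have "real n * (\<beta> / 2) < 1" .
    moreover have "1 < real n * (\<beta> / 2)" using n \<beta> by (simp add: field_simps)
    ultimately show False by simp
  qed
  then have "negligible E"
    unfolding locally_negligible_alt[of E]
  proof (intro ballI exI conjI)
    fix x assume "x \<in> E"
    then show "x \<in> E \<inter> {x - d / 4<..<x + d / 4}" using d by simp
    show "openin (top_of_set E) (E \<inter> {x - d / 4<..<x + d / 4})" by (rule openin_open_Int) simp
  qed
  then show ?thesis by (simp add: E_def)
qed

text \<open>The definition of \<open>steep_points\<close> only sees intervals with \<open>x\<close>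
  in the interior, whereas difference quotients at \<open>x\<close> use intervals that end at
  \<open>x\<close>. Widening such an interval slightly and using continuity of \<open>F\<close>
  bridges the two.\<close>

lemma not_steep_point:
  assumes F: "continuous_on {a..b} F" and x: "a < x" "x < b" "x \<notin> steep_points a b F s"
  obtains d where "0 < d" "\<And>y z. y \<le> x \<Longrightarrow> x \<le> z \<Longrightarrow> y < z \<Longrightarrow> z - y < d \<Longrightarrow> F z - F y \<le> s * (z - y)"
proof -
  from x(3) obtain d where d: "0 < d" and
    nex: "\<not> (\<exists>y z. y < x \<and> x < z \<and> {y..z} \<subseteq> {a..b} \<and> z - y < d \<and> s * (z - y) < F z - F y)"
    unfolding steep_points_def by blast
  have *: "F z - F y \<le> s * (z - y)" if "y < x" "x < z" "{y..z} \<subseteq> {a..b}" "z - y < d" for y z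
    using nex that by (meson not_le)
  show thesis
  proof (rule that[of "min d (min (x - a) (b - x))"])
    show "0 < min d (min (x - a) (b - x))" using d x by simp
    fix y z assume yz: "y \<le> x" "x \<le> z" "y < z" "z - y < min d (min (x - a) (b - x))"
    then have in_ab: "a < y" "y < b" "a < z" "z < b" "z - y < d" by auto
    show "F z - F y \<le> s * (z - y)"
    proof (rule ccontr)
      assume "\<not> F z - F y \<le> s * (z - y)"
      \<comment> \<open>The excess over slope \<open>s\<close> after widening by \<open>h\<close> on
        both sides. It tends to its value at 0, so a positive excess would survive for small
        \<open>h > 0\<close>.\<close>
      define H where "H h = F (z + h) - F (y - h) - s * ((z + h) - (y - h))" for h
      have pos: "0 < F z - F y - s * (z - y)" using \<open>\<not> F z - F y \<le> s * (z - y)\<close> by simp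
      have "isCont F z" "isCont F y"
        using in_ab by (auto intro!: continuous_on_interior[OF F])
      have "((\<lambda>h. z + h) \<longlongrightarrow> z) (at_right 0)" "((\<lambda>h. y - h) \<longlongrightarrow> y) (at_right 0)"
        by (auto intro!: tendsto_eq_intros)
      then have "((\<lambda>h. F (z + h)) \<longlongrightarrow> F z) (at_right 0)" "((\<lambda>h. F (y - h)) \<longlongrightarrow> F y) (at_right 0)"
        using \<open>isCont F z\<close> \<open>isCont F y\<close> by (auto intro: isCont_tendsto_compose)
      then have "(H \<longlongrightarrow> F z - F y - s * (z - y)) (at_right 0)"
        unfolding H_def by (auto intro!: tendsto_eq_intros)
      from order_tendstoD(1)[OF this pos] have "\<forall>\<^sub>F h in at_right 0. 0 < H h" .
      moreover have "\<forall>\<^sub>F h in at_right 0. h < min (min (y - a) (b - z)) ((d - (z - y)) / 2)"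
        using in_ab by (intro eventually_at_right_field[THEN iffD2]) (auto intro!: exI[of _ "min (min (y - a) (b - z)) ((d - (z - y)) / 2)"])
      ultimately have "\<forall>\<^sub>F h in at_right 0. 0 < H h \<and> h < min (min (y - a) (b - z)) ((d - (z - y)) / 2) \<and> 0 < h"
        using eventually_at_right_less[of "0::real"] by eventually_elim auto
      then obtain h where h: "0 < H h" "h < min (min (y - a) (b - z)) ((d - (z - y)) / 2)" "0 < h"
        using eventually_happens trivial_limit_at_right_real by blast
      have "F (z + h) - F (y - h) \<le> s * ((z + h) - (y - h))"
        using h(2,3) yz by (intro *) (auto simp: field_simps)
      then show False using h(1) by (simp add: H_def)
    qed
  qed
qed

section \<open>Lebesgue's differentiation theorem and the fundamental theorem of calculus\<close>

text \<open>Off \<open>N\<close>, the infimum of the slopes at which \<open>x\<close> is not steep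
  is the upper derivate; it is finite because neither \<open>F\<close> nor \<open>- F\<close> has an
  infinite upper derivate. A smaller lower derivate would leave room for two rationals
  \<open>r1 < r2\<close>, and the set belonging to such a pair is part of \<open>N\<close>.\<close>

theorem absolutely_continuous_on_differentiable_ae:
  fixes F :: "real \<Rightarrow> real"
  assumes F: "absolutely_continuous_on {a..b} F"
  obtains N where "negligible N" "\<And>x. x \<in> {a..b} - N \<Longrightarrow> \<exists>L. (F has_real_derivative L) (at x)"
proof -
  have cont: "continuous_on {a..b} F" by (rule absolutely_continuous_on_imp_continuous_on[OF F])
  then have cont': "continuous_on {a..b} (\<lambda>x. - F x)" by (intro continuous_intros)
  have F': "absolutely_continuous_on {a..b} (\<lambda>x. - F x)"
    by (rule absolutely_continuous_on_dominated[OF F, of _ 1 0]) auto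
  define N where "N = {a, b} \<union> (\<Inter>n::nat. steep_points a b F (real n)) \<union> (\<Inter>n::nat. steep_points a b (\<lambda>x. - F x) (real n))
     \<union> (\<Union>(r, s)\<in>{(r, s). r \<in> \<rat> \<and> s \<in> \<rat> \<and> r < s}. steep_points a b F s \<inter> steep_points a b (\<lambda>x. - F x) (- r))"
  have "countable {(r::real, s::real). r \<in> \<rat> \<and> s \<in> \<rat> \<and> r < s}"
    by (rule countable_subset[of _ "\<rat> \<times> \<rat>"]) (auto intro: countable_rat)
  then have "negligible N" unfolding N_def
    by (intro negligible_Un negligible_infinite_derivate F F' negligible_countable_Union countable_image)
      (auto intro: negligible_derivates_gap[OF F])
  moreover have "\<exists>L. (F has_real_derivative L) (at x)" if x: "x \<in> {a..b} - N" for x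
  proof -
    have x': "a < x" "x < b" using x by (auto simp: N_def less_le)
    define X where "X = {s. x \<notin> steep_points a b F s}"
    obtain n :: nat where n: "real n \<in> X" using x by (auto simp: N_def X_def)
    obtain m :: nat where m: "x \<notin> steep_points a b (\<lambda>x. - F x) (real m)" using x by (auto simp: N_def)
    obtain d where d: "0 < d" "\<And>y z. y \<le> x \<Longrightarrow> x \<le> z \<Longrightarrow> y < z \<Longrightarrow> z - y < d \<Longrightarrow> - F z - - F y \<le> real m * (z - y)"
      using not_steep_point[OF cont' x' m] by blast
    have "- real m \<le> s" if s: "s \<in> X" for s
    proof -
      from s have s: "x \<notin> steep_points a b F s" by (simp add: X_def)
      obtain e where e: "0 < e" "\<And>y z. y \<le> x \<Longrightarrow> x \<le> z \<Longrightarrow> y < z \<Longrightarrow> z - y < e \<Longrightarrow> F z - F y \<le> s * (z - y)"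
        using not_steep_point[OF cont x' s] by blast
      define h where "h = min d e / 2"
      have h: "0 < h" "h < d" "h < e" using d(1) e(1) by (auto simp: h_def)
      have "- F (x + h) - - F x \<le> real m * h" using d(2)[of x "x + h"] h by simp
      moreover have "F (x + h) - F x \<le> s * h" using e(2)[of x "x + h"] h by simp
      ultimately have "0 \<le> (real m + s) * h" by (simp add: distrib_right)
      then show ?thesis using h(1) by (simp add: zero_le_mult_iff)
    qed
    then have bdd: "bdd_below X" by (auto intro!: bdd_belowI)
    define L where "L = Inf X"
    have "((\<lambda>h. (F (x + h) - F x) / h) \<longlongrightarrow> L) (at 0)"
    proof (rule order_tendstoI)
      fix s assume "L < s"
      then obtain s' where s': "L < s'" "s' < s" using dense by blast
      then obtain s0 where "s0 \<in> X" "s0 < s'"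
        using cInf_lessD[of X s'] n by (auto simp: L_def)
      then have "x \<notin> steep_points a b F s'"
        using steep_points_antimono[of s0 s' a b F] by (auto simp: X_def)
      then obtain e where e: "0 < e" "\<And>y z. y \<le> x \<Longrightarrow> x \<le> z \<Longrightarrow> y < z \<Longrightarrow> z - y < e \<Longrightarrow> F z - F y \<le> s' * (z - y)"
        using not_steep_point[OF cont x'] by blast
      have "(F (x + h) - F x) / h < s" if h: "h \<noteq> 0" "\<bar>h\<bar> < e" for h
      proof (cases "0 < h")
        case True
        then have "F (x + h) - F x \<le> s' * h" using e(2)[of x "x + h"] h by simp
        then have "(F (x + h) - F x) / h \<le> s'" using True by (simp add: divide_le_eq)
        then show ?thesis using s' by simp
      next
        case False
        then have "F x - F (x + h) \<le> s' * (- h)" using e(2)[of "x + h" x] h by simp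
        then have "(F (x + h) - F x) / h \<le> s'" using False h by (simp add: divide_le_eq)
        then show ?thesis using s' by simp
      qed
      then show "\<forall>\<^sub>F h in at 0. (F (x + h) - F x) / h < s"
        unfolding eventually_at using e(1) by (intro exI[of _ e]) (auto simp: dist_real_def)
    next
      fix r assume "r < L"
      then obtain r1 where r1: "r1 \<in> \<rat>" "r < r1" "r1 < L" using Rats_dense_in_real by blast
      then obtain r2 where r2: "r2 \<in> \<rat>" "r1 < r2" "r2 < L" using Rats_dense_in_real by blast
      have "r2 \<notin> X" using cInf_lower[OF _ bdd] r2(3) unfolding L_def by force
      then have "x \<in> steep_points a b F r2" by (simp add: X_def)
      moreover have "x \<notin> steep_points a b F r2 \<inter> steep_points a b (\<lambda>x. - F x) (- r1)"
        using x r1(1) r2(1,2) unfolding N_def by blast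
      ultimately have "x \<notin> steep_points a b (\<lambda>x. - F x) (- r1)" by blast
      then obtain e where e: "0 < e" "\<And>y z. y \<le> x \<Longrightarrow> x \<le> z \<Longrightarrow> y < z \<Longrightarrow> z - y < e \<Longrightarrow> - F z - - F y \<le> - r1 * (z - y)"
        using not_steep_point[OF cont' x'] by blast
      have "r < (F (x + h) - F x) / h" if h: "h \<noteq> 0" "\<bar>h\<bar> < e" for h
      proof (cases "0 < h")
        case True
        then have "r1 * h \<le> F (x + h) - F x" using e(2)[of x "x + h"] h by simp
        then have "r1 \<le> (F (x + h) - F x) / h" using True by (simp add: le_divide_eq)
        then show ?thesis using r1 by simp
      next
        case False
        then have "F (x + h) - F x \<le> r1 * h" using e(2)[of "x + h" x] h by simp
        then have "r1 \<le> (F (x + h) - F x) / h" using False h by (simp add: le_divide_eq)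
        then show ?thesis using r1 by simp
      qed
      then show "\<forall>\<^sub>F h in at 0. r < (F (x + h) - F x) / h"
        unfolding eventually_at using e(1) by (intro exI[of _ e]) (auto simp: dist_real_def)
    qed
    then show ?thesis unfolding DERIV_def by blast
  qed
  ultimately show thesis by (rule that)
qed

text \<open>The gauge is given by differentiability at tags outside \<open>N\<close>; at tags in \<open>N\<close> it is a small
  open neighbourhood of \<open>N\<close>, and absolute continuity bounds their contribution.\<close>

theorem fundamental_theorem_of_calculus_absolutely_continuous:
  fixes F :: "real \<Rightarrow> real"
  assumes F: "absolutely_continuous_on {a..b} F" and "a \<le> b" and N: "negligible N"
    and deriv: "\<And>x. x \<in> {a..b} - N \<Longrightarrow> (F has_real_derivative f x) (at x within {a..b})"
  shows "(f has_integral (F b - F a)) {a..b}"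
proof -
  \<comment> \<open>\<open>f\<close> is arbitrary on \<open>N\<close>. With the value 0 there, tags
    in \<open>N\<close> contribute only the increments of \<open>F\<close> to the error.\<close>
  define f0 where "f0 x = (if x \<in> N then 0 else f x)" for x
  have "(f0 has_integral (F b - F a)) {a..b}"
    unfolding has_integral_real
  proof (intro allI impI)
    fix e :: real assume e: "0 < e"
    then have "0 < e / 2" by simp
    obtain \<delta> where \<delta>: "0 < \<delta>" and
      ac: "\<And>(A::(real \<times> real set) set) lo hi. finite A \<Longrightarrow>
        (\<And>i. i \<in> A \<Longrightarrow> lo i \<le> hi i \<and> {lo i..hi i} \<subseteq> {a..b}) \<Longrightarrow>
        disjoint_family_on (\<lambda>i. {lo i<..<hi i}) A \<Longrightarrow> (\<Sum>i\<in>A. hi i - lo i) < \<delta> \<Longrightarrow>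
        (\<Sum>i\<in>A. \<bar>F (hi i) - F (lo i)\<bar>) < e / 2"
      by (rule absolutely_continuous_onD[OF F \<open>0 < e / 2\<close>]) blast
    obtain T where T: "open T" "N \<subseteq> T" "T - N \<in> lmeasurable" "emeasure lebesgue (T - N) < ennreal \<delta>"
      using sets_lebesgue_outer_open[OF negligible_imp_sets[OF N] \<delta>] by blast
    have Tm: "T \<in> lmeasurable"
      using fmeasurable.Un[OF T(3) negligible_imp_measurable[OF N]] T(2) by (simp add: Un_absorb2)
    have "measure lebesgue T = measure lebesgue (T - N)"
      using N by (intro measure_negligible_symdiff T(3)) (auto intro: negligible_subset)
    then have T\<delta>: "measure lebesgue T < \<delta>"
      using T(4) \<delta> unfolding emeasure_eq_measure2[OF T(3)] by (simp add: ennreal_less_iff)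
    \<comment> \<open>The 1 guards against \<open>a = b\<close>.\<close>
    define e' where "e' = e / (2 * (b - a + 1))"
    have e': "0 < e'" using e \<open>a \<le> b\<close> by (simp add: e'_def)
    have e'_le: "e' * (b - a) \<le> e / 2" using e \<open>a \<le> b\<close> by (simp add: e'_def field_simps)
    have "\<exists>d>0. x \<in> {a..b} - N \<longrightarrow> (\<forall>y\<in>{a..b}. \<bar>y - x\<bar> < d \<longrightarrow> \<bar>F y - F x - f x * (y - x)\<bar> \<le> e' * \<bar>y - x\<bar>)" for x
    proof (cases "x \<in> {a..b} - N")
      case True
      from deriv[OF this] show ?thesis
        unfolding has_field_derivative_def has_derivative_within_alt using e' by fastforce
    qed (auto intro: exI[of _ 1])
    then obtain d where d: "\<And>x. 0 < d x"
      "\<And>x y. x \<in> {a..b} - N \<Longrightarrow> y \<in> {a..b} \<Longrightarrow> \<bar>y - x\<bar> < d x \<Longrightarrow> \<bar>F y - F x - f x * (y - x)\<bar> \<le> e' * \<bar>y - x\<bar>"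
      by metis
    define \<gamma> where "\<gamma> x = (if x \<in> N then T else ball x (d x))" for x
    have "gauge \<gamma>" unfolding gauge_def \<gamma>_def using T(1,2) d(1) by auto
    moreover have "norm ((\<Sum>(x, k)\<in>p. measure lborel k *\<^sub>R f0 x) - (F b - F a)) < e"
      if p: "p tagged_division_of {a..b}" and fine: "\<gamma> fine p" for p
    proof -
      have fin: "finite p" using p by blast
      have pK: "\<exists>u v. k = {u..v} \<and> u \<le> x \<and> x \<le> v \<and> {u..v} \<subseteq> {a..b}" if "(x, k) \<in> p" for x k
        using tagged_division_ofD(2-4)[OF p that] by (metis atLeastAtMost_iff box_real(2))
      define lo hi :: "real \<times> real set \<Rightarrow> real" where "lo i = Inf (snd i)" and "hi i = Sup (snd i)" for i
      have i: "snd i = {lo i..hi i} \<and> lo i \<le> fst i \<and> fst i \<le> hi i \<and> {lo i..hi i} \<subseteq> {a..b} \<and> measure lborel (snd i) = hi i - lo i"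
        if i: "i \<in> p" for i
      proof -
        obtain u v where uv: "snd i = {u..v} \<and> u \<le> fst i \<and> fst i \<le> v \<and> {u..v} \<subseteq> {a..b}"
          using pK[of "fst i" "snd i"] i by auto
        then have "lo i = u" "hi i = v" by (auto simp: lo_def hi_def)
        then show ?thesis using uv by auto
      qed
      have dis: "{lo i<..<hi i} \<inter> {lo j<..<hi j} = {}" if "i \<in> p" "j \<in> p" "i \<noteq> j" for i j
      proof -
        have "interior (snd i) \<inter> interior (snd j) = {}"
          using tagged_division_ofD(5)[OF p, of "fst i" "snd i" "fst j" "snd j"] that by auto
        moreover have "interior (snd i) = {lo i<..<hi i}" "interior (snd j) = {lo j<..<hi j}"
          using i that by (auto simp: interior_atLeastAtMost_real)
        ultimately show ?thesis by simp
      qed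
      define p1 p2 where "p1 = {i \<in> p. fst i \<in> N}" and "p2 = {i \<in> p. fst i \<notin> N}"
      have split: "(\<Sum>i\<in>p. g i) = (\<Sum>i\<in>p1. g i) + (\<Sum>i\<in>p2. g i)" for g :: "real \<times> real set \<Rightarrow> real"
      proof -
        have "p = p1 \<union> p2" "p1 \<inter> p2 = {}" "finite p1" "finite p2" using fin by (auto simp: p1_def p2_def)
        then show ?thesis by (metis sum.union_disjoint)
      qed
      have total: "(\<Sum>i\<in>p. F (hi i) - F (lo i)) = F b - F a"
        using additive_tagged_division_1[OF \<open>a \<le> b\<close> p, of F] by (simp add: lo_def hi_def split_def)
      have totallen: "(\<Sum>i\<in>p. hi i - lo i) = b - a"
        using additive_tagged_division_1[OF \<open>a \<le> b\<close> p, of "\<lambda>x. x"] by (simp add: lo_def hi_def split_def)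
      have "(\<Sum>(x, k)\<in>p. measure lborel k *\<^sub>R f0 x) - (F b - F a) = (\<Sum>i\<in>p. (hi i - lo i) * f0 (fst i) - (F (hi i) - F (lo i)))"
        unfolding total[symmetric] sum_subtractf[symmetric]
      proof (intro sum.cong refl)
        fix j assume "j \<in> p"
        then have "measure lborel (snd j) = hi j - lo j" using i by blast
        then show "(case j of (x, k) \<Rightarrow> measure lborel k *\<^sub>R f0 x) - (F (hi j) - F (lo j)) =
            (hi j - lo j) * f0 (fst j) - (F (hi j) - F (lo j))"
          by (simp add: split_def)
      qed
      also have "\<dots> = (\<Sum>i\<in>p1. (hi i - lo i) * f0 (fst i) - (F (hi i) - F (lo i)))
          + (\<Sum>i\<in>p2. (hi i - lo i) * f0 (fst i) - (F (hi i) - F (lo i)))" by (rule split)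
      finally have "\<bar>(\<Sum>(x, k)\<in>p. measure lborel k *\<^sub>R f0 x) - (F b - F a)\<bar>
          \<le> (\<Sum>i\<in>p1. \<bar>(hi i - lo i) * f0 (fst i) - (F (hi i) - F (lo i))\<bar>)
          + (\<Sum>i\<in>p2. \<bar>(hi i - lo i) * f0 (fst i) - (F (hi i) - F (lo i))\<bar>)"
        by (simp only: order_trans[OF abs_triangle_ineq add_mono[OF sum_abs sum_abs]])
      moreover have "(\<Sum>i\<in>p1. \<bar>(hi i - lo i) * f0 (fst i) - (F (hi i) - F (lo i))\<bar>) < e / 2"
      proof -
        have "(\<Sum>i\<in>p1. \<bar>(hi i - lo i) * f0 (fst i) - (F (hi i) - F (lo i))\<bar>) = (\<Sum>i\<in>p1. \<bar>F (hi i) - F (lo i)\<bar>)"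
          by (intro sum.cong) (auto simp: p1_def f0_def)
        also have "\<dots> < e / 2"
        proof (rule ac)
          show fin1: "finite p1" using fin by (simp add: p1_def)
          show "lo i \<le> hi i \<and> {lo i..hi i} \<subseteq> {a..b}" if "i \<in> p1" for i
            using i[of i] that by (auto simp: p1_def)
          show "disjoint_family_on (\<lambda>i. {lo i<..<hi i}) p1"
            unfolding disjoint_family_on_def using dis by (auto simp: p1_def)
          have "(\<Sum>i\<in>p1. hi i - lo i) = (\<Sum>i\<in>p1. measure lebesgue (snd i))"
          proof (intro sum.cong refl)
            fix j assume "j \<in> p1"
            then have "snd j = {lo j..hi j}" "lo j \<le> hi j" using i[of j] by (auto simp: p1_def)
            then show "hi j - lo j = measure lebesgue (snd j)" by simp
          qed
          also have "\<dots> = measure lebesgue (\<Union>(snd ` p1))"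
          proof (rule measure_negligible_finite_Union_image[OF fin1, symmetric])
            show "snd j \<in> lmeasurable" if "j \<in> p1" for j
              using i[of j] that by (metis (lifting) lmeasurable_interval(1) box_real(2) mem_Collect_eq p1_def)
            show "pairwise (\<lambda>i j. negligible (snd i \<inter> snd j)) p1"
              unfolding pairwise_def
            proof (intro ballI impI)
              fix j k assume jk: "j \<in> p1" "k \<in> p1" "j \<noteq> k"
              \<comment> \<open>Distinct intervals of the division share at most an end point, so
                their lengths add up to the measure of the union.\<close>
              have "snd j \<inter> snd k \<subseteq> {max (lo j) (lo k)}"
              proof
                fix x assume "x \<in> snd j \<inter> snd k"
                then have x: "max (lo j) (lo k) \<le> x" "x \<le> min (hi j) (hi k)"
                  using i[of j] i[of k] jk by (auto simp: p1_def)
                show "x \<in> {max (lo j) (lo k)}"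
                proof (rule ccontr)
                  assume "x \<notin> {max (lo j) (lo k)}"
                  then have "(max (lo j) (lo k) + x) / 2 \<in> {lo j<..<hi j} \<inter> {lo k<..<hi k}"
                    using x by (auto simp: max_def min_def split: if_splits)
                  then show False using dis[of j k] jk by (auto simp: p1_def)
                qed
              qed
              then show "negligible (snd j \<inter> snd k)"
                by (rule negligible_subset[rotated]) simp
            qed
          qed
          also have "\<dots> \<le> measure lebesgue T"
          proof (intro measure_mono_fmeasurable Tm)
            show "\<Union>(snd ` p1) \<subseteq> T"
              using fine unfolding fine_def p1_def \<gamma>_def by fastforce
            show "\<Union>(snd ` p1) \<in> sets lebesgue"
            proof (intro sets.finite_Union)
              show "snd ` p1 \<subseteq> sets lebesgue"
              proof safe
                fix x k assume "(x, k) \<in> p1"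
                then have "k = {lo (x, k)..hi (x, k)}" using i[of "(x, k)"] by (auto simp: p1_def)
                then show "snd (x, k) \<in> sets lebesgue" by (metis atLeastAtMost_borel sets_completionI_sets snd_conv sets_lborel)
              qed
            qed (use fin1 in simp)
          qed
          finally show "(\<Sum>i\<in>p1. hi i - lo i) < \<delta>" using T\<delta> by simp
        qed
        finally show ?thesis .
      qed
      moreover have "(\<Sum>i\<in>p2. \<bar>(hi i - lo i) * f0 (fst i) - (F (hi i) - F (lo i))\<bar>) \<le> e / 2"
      proof -
        have "(\<Sum>i\<in>p2. \<bar>(hi i - lo i) * f0 (fst i) - (F (hi i) - F (lo i))\<bar>) \<le> (\<Sum>i\<in>p2. e' * (hi i - lo i))"
        proof (rule sum_mono)
          fix j assume j: "j \<in> p2"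
          then have jp: "j \<in> p" and jN: "fst j \<notin> N" by (auto simp: p2_def)
          note ij = i[OF jp]
          have "snd j \<subseteq> ball (fst j) (d (fst j))"
            using fineD[OF fine, of "fst j" "snd j"] jp jN by (simp add: \<gamma>_def)
          moreover have "lo j \<in> snd j" "hi j \<in> snd j" using ij by auto
          ultimately have "lo j \<in> ball (fst j) (d (fst j))" "hi j \<in> ball (fst j) (d (fst j))" by blast+
          then have "\<bar>lo j - fst j\<bar> < d (fst j)" "\<bar>hi j - fst j\<bar> < d (fst j)"
            by (simp_all add: dist_real_def abs_minus_commute)
          moreover have "fst j \<in> {a..b} - N" "lo j \<in> {a..b}" "hi j \<in> {a..b}" using ij jN by auto
          ultimately have "\<bar>F (lo j) - F (fst j) - f (fst j) * (lo j - fst j)\<bar> \<le> e' * \<bar>lo j - fst j\<bar>"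
            "\<bar>F (hi j) - F (fst j) - f (fst j) * (hi j - fst j)\<bar> \<le> e' * \<bar>hi j - fst j\<bar>"
            using d(2) by blast+
          then have "\<bar>(F (lo j) - F (fst j) - f (fst j) * (lo j - fst j)) - (F (hi j) - F (fst j) - f (fst j) * (hi j - fst j))\<bar>
             \<le> e' * \<bar>lo j - fst j\<bar> + e' * \<bar>hi j - fst j\<bar>" by linarith
          also have "\<dots> = e' * (hi j - lo j)" using ij by (simp add: algebra_simps)
          finally show "\<bar>(hi j - lo j) * f0 (fst j) - (F (hi j) - F (lo j))\<bar> \<le> e' * (hi j - lo j)"
            using jN by (simp add: f0_def algebra_simps)
        qed
        also have "\<dots> \<le> (\<Sum>i\<in>p. e' * (hi i - lo i))"
        proof (rule sum_mono2[OF fin])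
          show "0 \<le> e' * (hi j - lo j)" if "j \<in> p - p2" for j
          proof -
            have "lo j \<le> hi j" using i[of j] that by auto
            then show ?thesis using e' by simp
          qed
        qed (simp add: p2_def)
        also have "\<dots> \<le> e / 2" using e'_le totallen by (simp add: sum_distrib_left[symmetric])
        finally show ?thesis .
      qed
      ultimately show ?thesis by simp
    qed
    ultimately show "\<exists>\<gamma>. gauge \<gamma> \<and> (\<forall>\<D>. \<D> tagged_division_of {a..b} \<and> \<gamma> fine \<D> \<longrightarrow>
        norm ((\<Sum>(x, k)\<in>\<D>. measure lborel k *\<^sub>R f0 x) - (F b - F a)) < e)"
      by (intro exI[of _ \<gamma>]) simp
  qed
  then show ?thesis
    by (rule has_integral_spike[OF N, rotated]) (simp add: f0_def)
qed

section \<open>The Euler-Lagrange equation\<close>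

lemma AE_lebesgue_onI:
  assumes "negligible N" "S \<in> sets lebesgue" "\<And>x. x \<in> S - N \<Longrightarrow> P x"
  shows "AE x in lebesgue_on S. P x"
proof -
  have "AE x in lebesgue. x \<notin> N"
    using assms(1) by (simp add: AE_not_in negligible_iff_null_sets)
  then have "AE x in lebesgue. x \<in> S \<longrightarrow> P x"
    by (rule AE_mp) (use assms(3) in auto)
  then show ?thesis using assms(2) by (simp add: AE_restrict_space_iff)
qed

lemma ereal_integral_eq:
  assumes \<phi>: "integrable M \<phi>" and F: "AE x in M. F x = ereal (\<phi> x)"
  shows "ereal_integral M F = ereal (integral\<^sup>L M \<phi>)"
proof -
  let ?P = "\<integral>\<^sup>+ x. ennreal (\<phi> x) \<partial>M" and ?N = "\<integral>\<^sup>+ x. ennreal (- \<phi> x) \<partial>M"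
  have P: "(\<integral>\<^sup>+ x. e2ennreal (F x) \<partial>M) = ?P" by (rule nn_integral_cong_AE) (use F in auto)
  have N: "(\<integral>\<^sup>+ x. e2ennreal (- F x) \<partial>M) = ?N" by (rule nn_integral_cong_AE) (use F in auto)
  have "?P \<noteq> \<infinity>" "?N \<noteq> \<infinity>" using \<phi> by (simp_all add: real_integrable_def)
  then obtain a b where ab: "?P = ennreal a" "0 \<le> a" "?N = ennreal b" "0 \<le> b"
    by (metis ennreal_cases infinity_ennreal_def)
  have "integral\<^sup>L M \<phi> = a - b"
    unfolding real_lebesgue_integral_def[OF \<phi>] using ab by simp
  then show ?thesis unfolding ereal_integral_def P N using ab by simp
qed

text \<open>The nonnegative integral is monotone for arbitrary functions, so a competitor's cost can
  be compared directly with an integrable majorant.\<close>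

lemma ereal_integral_mono_AE:
  assumes "AE x in M. F x \<le> G x"
  shows "ereal_integral M F \<le> ereal_integral M G"
  unfolding ereal_integral_def
proof (rule ereal_minus_mono)
  have "(\<integral>\<^sup>+ x. e2ennreal (F x) \<partial>M) \<le> (\<integral>\<^sup>+ x. e2ennreal (G x) \<partial>M)"
    by (rule nn_integral_mono_AE[OF eventually_mono[OF assms]]) (simp add: e2ennreal_mono)
  then show "enn2ereal (\<integral>\<^sup>+ x. e2ennreal (F x) \<partial>M) \<le> enn2ereal (\<integral>\<^sup>+ x. e2ennreal (G x) \<partial>M)"
    by (simp add: less_eq_ennreal.rep_eq)
  have "(\<integral>\<^sup>+ x. e2ennreal (- G x) \<partial>M) \<le> (\<integral>\<^sup>+ x. e2ennreal (- F x) \<partial>M)"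
    by (rule nn_integral_mono_AE[OF eventually_mono[OF assms]]) (simp add: e2ennreal_mono)
  then show "enn2ereal (\<integral>\<^sup>+ x. e2ennreal (- G x) \<partial>M) \<le> enn2ereal (\<integral>\<^sup>+ x. e2ennreal (- F x) \<partial>M)"
    by (simp add: less_eq_ennreal.rep_eq)
qed

text \<open>The negative part is bounded by \<open>c\<close> and so has finite integral; an infinite
  positive part would then make the difference infinite.\<close>

lemma integrable_of_ereal_integral_finite:
  assumes M: "finite_measure M" and \<phi>: "\<phi> \<in> borel_measurable M" "\<And>x. x \<in> space M \<Longrightarrow> - c \<le> \<phi> x"
    and F: "AE x in M. F x = ereal (\<phi> x)" and fin: "ereal_integral M F < \<infinity>"
  shows "integrable M \<phi>"
proof -
  interpret finite_measure M by (rule M)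
  have P: "(\<integral>\<^sup>+ x. e2ennreal (F x) \<partial>M) = (\<integral>\<^sup>+ x. ennreal (\<phi> x) \<partial>M)"
    by (rule nn_integral_cong_AE) (use F in auto)
  have N: "(\<integral>\<^sup>+ x. e2ennreal (- F x) \<partial>M) = (\<integral>\<^sup>+ x. ennreal (- \<phi> x) \<partial>M)"
    by (rule nn_integral_cong_AE) (use F in auto)
  have "(\<integral>\<^sup>+ x. ennreal (- \<phi> x) \<partial>M) \<le> (\<integral>\<^sup>+ x. ennreal c \<partial>M)"
  proof (rule nn_integral_mono)
    fix x assume "x \<in> space M"
    from \<phi>(2)[OF this] show "ennreal (- \<phi> x) \<le> ennreal c" by (intro ennreal_leI) linarith
  qed
  also have "\<dots> < \<infinity>" by (simp add: ennreal_mult_less_top emeasure_eq_measure)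
  finally have Nfin: "(\<integral>\<^sup>+ x. ennreal (- \<phi> x) \<partial>M) \<noteq> \<infinity>" by simp
  have "(\<integral>\<^sup>+ x. ennreal (\<phi> x) \<partial>M) \<noteq> \<infinity>"
  proof
    assume "(\<integral>\<^sup>+ x. ennreal (\<phi> x) \<partial>M) = \<infinity>"
    then have "ereal_integral M F = \<infinity>" unfolding ereal_integral_def P N by simp
    then show False using fin by simp
  qed
  then show ?thesis using Nfin \<phi>(1) by (simp add: real_integrable_def)
qed

text \<open>Writing the increment in double angles isolates two errors,
  \<open>sin (2 * h) / 2 - h\<close> and \<open>(sin h)\<^sup>2\<close>. Each is at most
  \<open>h\<^sup>2\<close>, uniformly in \<open>x\<close>, which gives the constant 2.\<close>

lemma sin_square_expansion:
  fixes x h :: real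
  shows "\<bar>(sin (x + h))\<^sup>2 - (sin x)\<^sup>2 - h * sin (2 * x)\<bar> \<le> 2 * h\<^sup>2"
proof -
  have "(sin (x + h))\<^sup>2 - (sin x)\<^sup>2 = (sin x * cos h + cos x * sin h)\<^sup>2 - (sin x)\<^sup>2"
    by (simp add: sin_add)
  also have "\<dots> = 2 * sin x * cos x * (sin h * cos h) + ((cos x)\<^sup>2 - (sin x)\<^sup>2) * (sin h)\<^sup>2"
    using sin_cos_squared_add[of h] by (simp add: power2_eq_square) algebra
  also have "\<dots> = sin (2 * x) * (sin (2 * h) / 2) + cos (2 * x) * (sin h)\<^sup>2"
    by (simp add: sin_double cos_double)
  finally have eq: "(sin (x + h))\<^sup>2 - (sin x)\<^sup>2 - h * sin (2 * x) =
      sin (2 * x) * (sin (2 * h) / 2 - h) + cos (2 * x) * (sin h)\<^sup>2" by (simp add: algebra_simps)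
  \<comment> \<open>Taylor bound of order 2 at \<open>2 * h\<close>: half the square of the
    argument.\<close>
  have "\<bar>sin (2 * h) - 2 * h\<bar> \<le> 2 * h\<^sup>2"
    using Maclaurin_sin_bound[of "2 * h" 2]
    by (simp add: numeral_2_eq_2 sin_coeff_def power2_eq_square)
  then have 1: "\<bar>sin (2 * h) / 2 - h\<bar> \<le> h\<^sup>2" by linarith
  have "\<bar>sin (2 * x) * (sin (2 * h) / 2 - h)\<bar> \<le> 1 * h\<^sup>2"
    unfolding abs_mult by (rule mult_mono[OF abs_sin_le_one 1]) auto
  moreover have "\<bar>cos (2 * x) * (sin h)\<^sup>2\<bar> \<le> 1 * h\<^sup>2"
  proof -
    have "(sin h)\<^sup>2 \<le> h\<^sup>2" using abs_sin_x_le_abs_x[of h] by (simp add: abs_le_square_iff)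
    then show ?thesis unfolding abs_mult by (intro mult_mono abs_cos_le_one) auto
  qed
  ultimately show ?thesis unfolding eq by linarith
qed

text \<open>The form in which minimality enters \<open>first_variation\<close>, with
  \<open>e\<close> the size of the variation.\<close>

lemma linear_term_zero:
  fixes A B :: real
  assumes "\<And>e. 0 \<le> e * A + e\<^sup>2 * B"
  shows "A = 0"
proof (rule ccontr)
  assume A: "A \<noteq> 0"
  define C where "C = \<bar>B\<bar> + 1"
  have C: "0 < C" "B < C" by (auto simp: C_def)
  \<comment> \<open>At this \<open>e\<close> the linear term is \<open>- A\<^sup>2 / C\<close>,
    while the quadratic one stays below \<open>A\<^sup>2 / C\<close> because
    \<open>B < C\<close>.\<close>
  have "0 \<le> (- A / C) * A + (- A / C)\<^sup>2 * B" by (rule assms)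
  also have "\<dots> = A\<^sup>2 * (B - C) / C\<^sup>2" using C by (simp add: field_simps power2_eq_square)
  also have "\<dots> < 0" using A C by (intro divide_neg_pos mult_pos_neg) auto
  finally show False by simp
qed

lemma has_real_derivative_quadratic_bound:
  fixes f :: "real \<Rightarrow> real"
  assumes "\<And>y. y \<in> S \<Longrightarrow> \<bar>f y - f x - (y - x) * L\<bar> \<le> C * (y - x)\<^sup>2"
  shows "(f has_real_derivative L) (at x within S)"
  unfolding has_field_derivative_def has_derivative_within_alt
proof (intro conjI allI impI)
  show "bounded_linear ((*) L)" by (rule bounded_linear_mult_right)
  fix e :: real assume e: "0 < e"
  define d where "d = e / (\<bar>C\<bar> + 1)"
  show "\<exists>d>0. \<forall>y\<in>S. norm (y - x) < d \<longrightarrow> norm (f y - f x - L * (y - x)) \<le> e * norm (y - x)"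
  proof (intro exI[of _ d] conjI ballI impI)
    show "0 < d" using e by (simp add: d_def)
    fix y assume y: "y \<in> S" "norm (y - x) < d"
    have "\<bar>f y - f x - L * (y - x)\<bar> \<le> C * (y - x)\<^sup>2" using assms[OF y(1)] by (simp add: mult.commute)
    also have "\<dots> \<le> (\<bar>C\<bar> + 1) * (y - x)\<^sup>2" by (intro mult_right_mono) auto
    also have "\<dots> = (\<bar>C\<bar> + 1) * \<bar>y - x\<bar> * \<bar>y - x\<bar>" by (simp add: power2_eq_square)
    also have "\<dots> \<le> (\<bar>C\<bar> + 1) * d * \<bar>y - x\<bar>" using y(2) by (intro mult_right_mono mult_left_mono) auto
    also have "\<dots> = e * \<bar>y - x\<bar>" by (simp add: d_def)
    finally show "norm (f y - f x - L * (y - x)) \<le> e * norm (y - x)" by simp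
  qed
qed

lemma bounded_measurable_integrable_on:
  fixes f :: "real \<Rightarrow> real"
  assumes f: "f \<in> borel_measurable (lebesgue_on {a..b})" and B: "\<And>x. x \<in> {a..b} \<Longrightarrow> \<bar>f x\<bar> \<le> B"
  shows "f integrable_on {a..b}" "integrable (lebesgue_on {a..b}) f"
proof -
  show int: "integrable (lebesgue_on {a..b}) f"
    by (rule finite_measure.integrable_const_bound[of _ _ B])
      (use B f in \<open>auto intro!: finite_measure_lebesgue_on AE_I2\<close>)
  then show "f integrable_on {a..b}" by (intro integrable_on_lebesgue_on) auto
qed

lemma has_real_derivative_arcsin_sqrt:
  fixes x :: real
  assumes "0 < x" "x < 1"
  shows "((\<lambda>x. arcsin (sqrt x)) has_real_derivative inverse (2 * sqrt x * sqrt (1 - x))) (at x)"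
proof -
  have s: "0 < sqrt x" "sqrt x < 1" using assms by (auto simp: real_less_lsqrt)
  then have "- 1 < sqrt x" by linarith
  have "((\<lambda>x. arcsin (sqrt x)) has_real_derivative inverse (sqrt (1 - (sqrt x)\<^sup>2)) * (inverse (sqrt x) / 2)) (at x)"
    by (rule DERIV_chain2[OF DERIV_arcsin DERIV_real_sqrt]) (use s \<open>- 1 < sqrt x\<close> assms in auto)
  then show ?thesis using assms by (simp add: field_simps)
qed

text \<open>The derivative of \<open>arcsin (sqrt x)\<close> blows up at 0 and 1. On
  \<open>[m, M]\<close> the two factors of its denominator are bounded below separately, one by its
  value at \<open>m\<close> and the other by its value at \<open>M\<close>.\<close>

lemma arcsin_sqrt_lipschitz:
  fixes m :: real
  assumes m: "0 < m" "M < 1" and xy: "x \<in> {m..M}" "y \<in> {m..M}"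
  shows "\<bar>arcsin (sqrt y) - arcsin (sqrt x)\<bar> \<le> inverse (2 * sqrt m * sqrt (1 - M)) * \<bar>y - x\<bar>"
proof -
  have "norm (arcsin (sqrt y) - arcsin (sqrt x)) \<le> inverse (2 * sqrt m * sqrt (1 - M)) * norm (y - x)"
  proof (rule field_differentiable_bound[where f = "\<lambda>x. arcsin (sqrt x)" and S = "{m..M}"
        and f' = "\<lambda>z. inverse (2 * sqrt z * sqrt (1 - z))"])
    fix z assume z: "z \<in> {m..M}"
    then show "((\<lambda>x. arcsin (sqrt x)) has_real_derivative inverse (2 * sqrt z * sqrt (1 - z))) (at z within {m..M})"
      using m by (intro has_field_derivative_at_within[OF has_real_derivative_arcsin_sqrt]) auto
    have "2 * sqrt m * sqrt (1 - M) \<le> 2 * sqrt z * sqrt (1 - z)"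
      using z m by (intro mult_mono) auto
    then have "inverse (2 * sqrt z * sqrt (1 - z)) \<le> inverse (2 * sqrt m * sqrt (1 - M))"
      using z m by (intro le_imp_inverse_le) auto
    then show "norm (inverse (2 * sqrt z * sqrt (1 - z))) \<le> inverse (2 * sqrt m * sqrt (1 - M))"
      using z m by simp
  qed (use xy in auto)
  then show ?thesis by simp
qed

lemma deriv01_eq:
  assumes "(f has_real_derivative D) (at t within {0..1})" "t \<in> {0..1}"
  shows "deriv01 f t = D"
  unfolding deriv01_def
  by (rule vector_derivative_within_closed_interval)
    (use assms in \<open>auto simp: has_real_derivative_iff_has_vector_derivative\<close>)

lemma absolutely_continuous_on_subset:
  "absolutely_continuous_on S f \<Longrightarrow> T \<subseteq> S \<Longrightarrow> absolutely_continuous_on T f"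
  unfolding absolutely_continuous_on_def by (meson order_trans)

section \<open>The optimal path in the angle variable\<close>

locale interior_optimum =
  fixes u p :: "real \<Rightarrow> real"
  assumes mono_u: "mono_on {0..1} u"
    and optimal: "optimal_solution u p"
    and interior: "interior_path p"
begin

definition \<theta> :: "real \<Rightarrow> real" where "\<theta> t = arcsin (sqrt (p t))"

text \<open>Almost everywhere the derivative of \<open>\<theta>\<close>.\<close>

definition g :: "real \<Rightarrow> real" where "g t = deriv01 p t / sin (2 * \<theta> t)"

text \<open>The derivative in \<open>x\<close> of the reward \<open>u t * (sin x)\<^sup>2\<close> at
  \<open>x = \<theta> t\<close>, that is, the reward term of the Euler-Lagrange equation.\<close>

definition v :: "real \<Rightarrow> real" where "v t = u t * sin (2 * \<theta> t)"

text \<open>Bounds \<open>u\<close> on \<open>[0, 1]\<close> by monotonicity, and serves as a crude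
  Lipschitz constant for \<open>R\<close>.\<close>

definition C :: real where "C = max \<bar>u 0\<bar> \<bar>u 1\<bar>"

lemma p_AC: "absolutely_continuous_on {0..1} p"
  using optimal by (simp add: optimal_solution_def admissible_def)

lemma p_cont: "continuous_on {0..1} p"
  by (rule absolutely_continuous_on_imp_continuous_on[OF p_AC])

lemma p_range: "t \<in> {0..1} \<Longrightarrow> 0 < p t \<and> p t < 1"
  using interior by (simp add: interior_path_def)

lemma
  assumes t: "t \<in> {0..1}"
  shows sin_theta: "sin (\<theta> t) = sqrt (p t)" and cos_theta: "cos (\<theta> t) = sqrt (1 - p t)"
proof -
  have "0 < sqrt (p t)" "sqrt (p t) < 1" using p_range[OF t] by (auto simp: real_less_lsqrt)
  then have s: "- 1 \<le> sqrt (p t)" "sqrt (p t) \<le> 1" by linarith+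
  show "sin (\<theta> t) = sqrt (p t)" unfolding \<theta>_def using s by (rule sin_arcsin)
  show "cos (\<theta> t) = sqrt (1 - p t)"
    unfolding \<theta>_def using s p_range[OF t] by (simp add: cos_arcsin)
qed

lemma p_eq: "t \<in> {0..1} \<Longrightarrow> p t = (sin (\<theta> t))\<^sup>2"
  using p_range[of t] by (simp add: sin_theta)

lemma sin_2theta_eq: "t \<in> {0..1} \<Longrightarrow> sin (2 * \<theta> t) = 2 * sqrt (p t) * sqrt (1 - p t)"
  by (simp add: sin_double sin_theta cos_theta)

lemma sin_2theta_pos: "t \<in> {0..1} \<Longrightarrow> 0 < sin (2 * \<theta> t)"
  using p_range[of t] by (simp add: sin_2theta_eq)

text \<open>The continuous \<open>p\<close> attains its extrema, and these lie strictly between 0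
  and 1. Its values thus stay in a compact interval on which the arcsine of the square root is
  Lipschitz.\<close>

lemma theta_dominated:
  obtains A where "\<And>x y. x \<in> {0..1} \<Longrightarrow> y \<in> {0..1} \<Longrightarrow> \<bar>\<theta> y - \<theta> x\<bar> \<le> A * \<bar>p y - p x\<bar>"
proof -
  obtain a where a: "a \<in> {0..1}" "\<And>t. t \<in> {0..1} \<Longrightarrow> p a \<le> p t"
    using continuous_attains_inf[OF _ _ p_cont] by fastforce
  obtain b where b: "b \<in> {0..1}" "\<And>t. t \<in> {0..1} \<Longrightarrow> p t \<le> p b"
    using continuous_attains_sup[OF _ _ p_cont] by fastforce
  show thesis
  proof (rule that)
    fix x y :: real assume xy: "x \<in> {0..1}" "y \<in> {0..1}"
    show "\<bar>\<theta> y - \<theta> x\<bar> \<le> inverse (2 * sqrt (p a) * sqrt (1 - p b)) * \<bar>p y - p x\<bar>"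
      unfolding \<theta>_def using p_range[OF a(1)] p_range[OF b(1)] a(2) b(2) xy
      by (intro arcsin_sqrt_lipschitz) auto
  qed
qed

lemma theta_AC: "absolutely_continuous_on {0..1} \<theta>"
proof -
  obtain A where A: "\<And>x y. x \<in> {0..1} \<Longrightarrow> y \<in> {0..1} \<Longrightarrow> \<bar>\<theta> y - \<theta> x\<bar> \<le> A * \<bar>p y - p x\<bar>"
    using theta_dominated by blast
  show ?thesis
    by (rule absolutely_continuous_on_dominated[OF p_AC, of _ A 0]) (use A in simp)
qed

lemma theta_cont: "continuous_on {0..1} \<theta>"
  by (rule absolutely_continuous_on_imp_continuous_on[OF theta_AC])

lemma derivatives_ae:
  obtains N where "negligible N"
    "\<And>t. t \<in> {0..1} - N \<Longrightarrow> (\<theta> has_real_derivative g t) (at t within {0..1})"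
proof -
  obtain N where N: "negligible N" "\<And>x. x \<in> {0..1} - N \<Longrightarrow> \<exists>L. (p has_real_derivative L) (at x)"
    using absolutely_continuous_on_differentiable_ae[OF p_AC] by blast
  show thesis
  proof (rule that[OF N(1)])
    fix t assume t: "t \<in> {0..1} - N"
    then obtain L where "(p has_real_derivative L) (at t)" using N(2) by blast
    then have L: "(p has_real_derivative L) (at t within {0..1})" by (rule has_field_derivative_at_within)
    then have dL: "deriv01 p t = L" using t by (intro deriv01_eq) auto
    have "(\<theta> has_real_derivative inverse (2 * sqrt (p t) * sqrt (1 - p t)) * L) (at t within {0..1})"
      unfolding \<theta>_def
      by (rule DERIV_chain2[OF has_real_derivative_arcsin_sqrt L]) (use p_range t in auto)
    moreover have "inverse (2 * sqrt (p t) * sqrt (1 - p t)) * L = g t"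
    proof -
      have "t \<in> {0..1}" using t by blast
      from sin_2theta_eq[OF this] show ?thesis
        unfolding g_def dL by (simp only: divide_inverse_commute)
    qed
    ultimately show "(\<theta> has_real_derivative g t) (at t within {0..1})" by simp
  qed
qed

text \<open>Besides expressing increments of \<open>\<theta>\<close>, this is where the
  measurability of \<open>g\<close> comes from.\<close>

lemma theta_FTC:
  assumes "0 \<le> x" "x \<le> y" "y \<le> 1"
  shows "(g has_integral (\<theta> y - \<theta> x)) {x..y}"
proof -
  obtain N where N: "negligible N" "\<And>t. t \<in> {0..1} - N \<Longrightarrow> (\<theta> has_real_derivative g t) (at t within {0..1})"
    using derivatives_ae by blast
  have sub: "{x..y} \<subseteq> {0..1}" using assms by auto
  show ?thesis
  proof (rule fundamental_theorem_of_calculus_absolutely_continuous[OF _ assms(2) N(1)])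
    show "absolutely_continuous_on {x..y} \<theta>" by (rule absolutely_continuous_on_subset[OF theta_AC sub])
    show "(\<theta> has_real_derivative g t) (at t within {x..y})" if "t \<in> {x..y} - N" for t
      by (rule has_field_derivative_subset[OF N(2) sub]) (use that sub in auto)
  qed
qed

lemma u_bound: "t \<in> {0..1} \<Longrightarrow> \<bar>u t\<bar> \<le> C"
  using mono_onD[OF mono_u, of 0 t] mono_onD[OF mono_u, of t 1] by (auto simp: C_def)

lemma C_nonneg: "0 \<le> C" by (simp add: C_def)

lemma v_bound: assumes "t \<in> {0..1}" shows "\<bar>v t\<bar> \<le> C"
proof -
  have "\<bar>v t\<bar> \<le> C * 1" unfolding v_def abs_mult by (intro mult_mono u_bound assms C_nonneg) auto
  then show ?thesis by simp
qed

lemma measurable_facts [measurable]: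
  shows u_meas: "u \<in> borel_measurable (lebesgue_on {0..1})"
    and theta_meas: "\<theta> \<in> borel_measurable (lebesgue_on {0..1})"
    and p_meas: "p \<in> borel_measurable (lebesgue_on {0..1})"
    and g_meas: "g \<in> borel_measurable (lebesgue_on {0..1})"
    and v_meas: "v \<in> borel_measurable (lebesgue_on {0..1})"
proof -
  show [measurable]: "u \<in> borel_measurable (lebesgue_on {0..1})"
    by (intro integrable_imp_measurable integrable_on_mono_on mono_u)
  show [measurable]: "\<theta> \<in> borel_measurable (lebesgue_on {0..1})"
    by (intro continuous_imp_measurable_on_sets_lebesgue theta_cont) auto
  show "p \<in> borel_measurable (lebesgue_on {0..1})"
    by (intro continuous_imp_measurable_on_sets_lebesgue p_cont) auto
  show "g \<in> borel_measurable (lebesgue_on {0..1})"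
    by (intro integrable_imp_measurable has_integral_integrable[OF theta_FTC]) auto
  show "v \<in> borel_measurable (lebesgue_on {0..1})"
    unfolding v_def by measurable
qed

lemma v_integrable: "v integrable_on {0..1}"
  by (rule bounded_measurable_integrable_on[OF v_meas v_bound])

text \<open>Interiority turns \<open>cost_rate p t\<close> into \<open>4 * (g t)\<^sup>2\<close>.
  The reward is bounded by \<open>C\<close>, so the finite optimal cost makes this square
  integrable, and \<open>g\<close> is dominated by \<open>1 + (g t)\<^sup>2\<close>.\<close>

lemma g_square_integrable: "integrable (lebesgue_on {0..1}) (\<lambda>t. (g t)\<^sup>2)"
  and g_integrable: "integrable (lebesgue_on {0..1}) g"
  and J_P_eq: "J_P u p = ereal (\<integral>t. (4 * (g t)\<^sup>2 - u t * p t) \<partial>lebesgue_on {0..1})"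
proof -
  let ?M = "lebesgue_on {0..1::real}"
  have fin: "finite_measure ?M" by (intro finite_measure_lebesgue_on) auto
  have cost: "cost_rate p t = ereal (4 * (g t)\<^sup>2)" if t: "t \<in> {0..1}" for t
  proof -
    have "p t \<notin> {0, 1}" using p_range[OF t] by auto
    then have "cost_rate p t = ereal ((deriv01 p t)\<^sup>2 / (p t * (1 - p t)))" by (simp add: cost_rate_def)
    also have "(deriv01 p t)\<^sup>2 / (p t * (1 - p t)) = 4 * (g t)\<^sup>2"
      unfolding g_def sin_2theta_eq[OF t] using p_range[OF t]
      by (simp add: power_divide power_mult_distrib field_simps)
    finally show ?thesis .
  qed
  have up_bound: "\<bar>u t * p t\<bar> \<le> C" if t: "t \<in> {0..1}" for t
  proof -
    have "\<bar>u t * p t\<bar> \<le> C * 1"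
      unfolding abs_mult using p_range[OF t] by (intro mult_mono u_bound t C_nonneg) auto
    then show ?thesis by simp
  qed
  have up: "integrable ?M (\<lambda>t. u t * p t)"
    by (rule bounded_measurable_integrable_on(2)[OF _ up_bound]) measurable
  let ?\<phi> = "\<lambda>t. 4 * (g t)\<^sup>2 - u t * p t"
  have AE: "AE t in ?M. cost_rate p t - ereal (u t * p t) = ereal (?\<phi> t)"
    using cost by (intro AE_I2) simp
  have \<phi>: "integrable ?M ?\<phi>"
  proof (rule integrable_of_ereal_integral_finite[OF fin _ _ AE])
    show "?\<phi> \<in> borel_measurable ?M" by measurable
    show "- C \<le> ?\<phi> t" if "t \<in> space ?M" for t
    proof -
      have "\<bar>u t * p t\<bar> \<le> C" using up_bound[of t] that by simp
      moreover have "0 \<le> (g t)\<^sup>2" by simp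
      ultimately show ?thesis by linarith
    qed
    show "ereal_integral ?M (\<lambda>t. cost_rate p t - ereal (u t * p t)) < \<infinity>"
      using optimal by (simp add: optimal_solution_def J_P_def)
  qed
  show "J_P u p = ereal (\<integral>t. ?\<phi> t \<partial>?M)"
    unfolding J_P_def by (rule ereal_integral_eq[OF \<phi> AE])
  have "integrable ?M (\<lambda>t. ?\<phi> t + u t * p t)" by (rule Bochner_Integration.integrable_add[OF \<phi> up])
  then have "integrable ?M (\<lambda>t. 4 * (g t)\<^sup>2)" by simp
  then show sq: "integrable ?M (\<lambda>t. (g t)\<^sup>2)" by simp
  have "integrable ?M (\<lambda>t. 1 + (g t)\<^sup>2)"
    by (intro Bochner_Integration.integrable_add sq finite_measure.integrable_const fin)
  then show "integrable ?M g"
  proof (rule measurable_bounded_by_integrable_imp_lebesgue_integrable[OF g_meas])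
    fix t
    have "2 * \<bar>g t\<bar> \<le> 1 + (g t)\<^sup>2" using sum_squares_bound[of 1 "\<bar>g t\<bar>"] by simp
    moreover have "0 \<le> \<bar>g t\<bar>" by simp
    ultimately have "\<bar>g t\<bar> \<le> 1 + (g t)\<^sup>2" by linarith
    then show "norm (g t) \<le> 1 + (g t)\<^sup>2" by simp
  qed auto
qed

section \<open>Variations of the angle\<close>

text \<open>The squared sine has values in \<open>[0, 1]\<close> and Lipschitz constant 1, so
  \<open>e\<close> may have any size and sign, and absolute continuity passes from
  \<open>\<theta>\<close> and \<open>\<eta>\<close> to the varied path.\<close>

lemma admissible_variation:
  assumes \<eta>: "\<And>x y. x \<in> {0..1} \<Longrightarrow> y \<in> {0..1} \<Longrightarrow> \<bar>\<eta> y - \<eta> x\<bar> \<le> B * \<bar>y - x\<bar>"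
  shows "admissible (\<lambda>t. (sin (\<theta> t + e * \<eta> t))\<^sup>2)"
  unfolding admissible_def
proof
  show "absolutely_continuous_on {0..1} (\<lambda>t. (sin (\<theta> t + e * \<eta> t))\<^sup>2)"
  proof (rule absolutely_continuous_on_dominated[OF theta_AC, of _ 1 "\<bar>e\<bar> * B"])
    fix x y :: real assume xy: "x \<in> {0..1}" "y \<in> {0..1}"
    let ?\<xi> = "\<lambda>t. \<theta> t + e * \<eta> t"
    have lip: "\<bar>(sin b)\<^sup>2 - (sin a)\<^sup>2\<bar> \<le> \<bar>b - a\<bar>" for a b :: real
    proof -
      have "sin (b + a) * sin (b - a) = (sin b * cos a)\<^sup>2 - (cos b * sin a)\<^sup>2"
        by (simp add: sin_add sin_diff power2_eq_square algebra_simps)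
      also have "\<dots> = (sin b)\<^sup>2 - (sin a)\<^sup>2"
        by (simp add: power_mult_distrib cos_squared_eq algebra_simps)
      finally have "\<bar>(sin b)\<^sup>2 - (sin a)\<^sup>2\<bar> = \<bar>sin (b + a)\<bar> * \<bar>sin (b - a)\<bar>"
        by (metis abs_mult)
      also have "\<dots> \<le> 1 * \<bar>b - a\<bar>"
        by (intro mult_mono abs_sin_le_one abs_sin_x_le_abs_x) auto
      finally show ?thesis by simp
    qed
    have "\<bar>(sin (?\<xi> y))\<^sup>2 - (sin (?\<xi> x))\<^sup>2\<bar> \<le> \<bar>?\<xi> y - ?\<xi> x\<bar>" by (rule lip)
    also have "?\<xi> y - ?\<xi> x = (\<theta> y - \<theta> x) + e * (\<eta> y - \<eta> x)" by (simp add: algebra_simps)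
    also have "\<bar>\<dots>\<bar> \<le> \<bar>\<theta> y - \<theta> x\<bar> + \<bar>e\<bar> * \<bar>\<eta> y - \<eta> x\<bar>"
      using abs_triangle_ineq[of "\<theta> y - \<theta> x" "e * (\<eta> y - \<eta> x)"] by (simp add: abs_mult)
    also have "\<bar>e\<bar> * \<bar>\<eta> y - \<eta> x\<bar> \<le> \<bar>e\<bar> * (B * \<bar>y - x\<bar>)" by (intro mult_left_mono \<eta> xy) auto
    finally show "\<bar>(sin (?\<xi> y))\<^sup>2 - (sin (?\<xi> x))\<^sup>2\<bar> \<le> 1 * \<bar>\<theta> y - \<theta> x\<bar> + \<bar>e\<bar> * B * \<bar>y - x\<bar>"
      by (simp add: mult.assoc)
  qed
  show "(\<lambda>t. (sin (\<theta> t + e * \<eta> t))\<^sup>2) \<in> {0..1} \<rightarrow> {0..1}"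
    by (auto simp: abs_square_le_1)
qed

text \<open>In the angle variable the cost is \<open>4 (\<xi>')\<^sup>2\<close>; this bound needs no smallness of the
  variation, because \<open>(sin \<xi>)\<^sup>2\<close> has derivative zero wherever it is \<open>0\<close> or \<open>1\<close>.\<close>

lemma cost_rate_sin_square_le:
  assumes \<xi>: "(\<xi> has_real_derivative D) (at t within {0..1})" and t: "t \<in> {0..1}"
  shows "cost_rate (\<lambda>t. (sin (\<xi> t))\<^sup>2) t \<le> ereal (4 * D\<^sup>2)"
proof -
  have "((\<lambda>t. (sin (\<xi> t))\<^sup>2) has_real_derivative 2 * sin (\<xi> t) * cos (\<xi> t) * D) (at t within {0..1})"
    by (rule derivative_eq_intros \<xi> refl)+ simp
  then have d: "deriv01 (\<lambda>t. (sin (\<xi> t))\<^sup>2) t = 2 * sin (\<xi> t) * cos (\<xi> t) * D"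
    using t by (rule deriv01_eq)
  have c: "1 - (sin (\<xi> t))\<^sup>2 = (cos (\<xi> t))\<^sup>2" using sin_cos_squared_add[of "\<xi> t"] by linarith
  show ?thesis
  proof (cases "(sin (\<xi> t))\<^sup>2 \<in> {0, 1}")
    case True
    then have "sin (\<xi> t) = 0 \<or> cos (\<xi> t) = 0" using c by auto
    then have "deriv01 (\<lambda>t. (sin (\<xi> t))\<^sup>2) t = 0" using d by auto
    then show ?thesis using True by (simp add: cost_rate_def)
  next
    case False
    then have nz: "sin (\<xi> t) \<noteq> 0" "cos (\<xi> t) \<noteq> 0" using c by auto
    have "cost_rate (\<lambda>t. (sin (\<xi> t))\<^sup>2) t =
        ereal ((2 * sin (\<xi> t) * cos (\<xi> t) * D)\<^sup>2 / ((sin (\<xi> t))\<^sup>2 * (cos (\<xi> t))\<^sup>2))"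
      using False by (simp add: cost_rate_def d c)
    also have "(2 * sin (\<xi> t) * cos (\<xi> t) * D)\<^sup>2 / ((sin (\<xi> t))\<^sup>2 * (cos (\<xi> t))\<^sup>2) = 4 * D\<^sup>2"
      using nz by (simp add: power_mult_distrib)
    finally show ?thesis by simp
  qed
qed

text \<open>The weak Euler-Lagrange equation. The path with angle
  \<open>\<theta> + e * \<eta>\<close> costs at most the integral of \<open>\<psi>\<close>, a
  quadratic in \<open>e\<close> whose value at 0 is the optimal cost, so minimality makes its linear
  coefficient vanish.\<close>

lemma first_variation:
  assumes lip: "\<And>x y. x \<in> {0..1} \<Longrightarrow> y \<in> {0..1} \<Longrightarrow> \<bar>\<eta> y - \<eta> x\<bar> \<le> B * \<bar>y - x\<bar>"
    and N': "negligible N'" "\<And>t. t \<in> {0..1} - N' \<Longrightarrow> (\<eta> has_real_derivative \<eta>' t) (at t within {0..1})"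
    and \<eta>': "\<eta>' \<in> borel_measurable (lebesgue_on {0..1})" "\<And>t. t \<in> {0..1} \<Longrightarrow> \<bar>\<eta>' t\<bar> \<le> B'"
  shows "8 * (\<integral>t. g t * \<eta>' t \<partial>lebesgue_on {0..1}) = (\<integral>t. v t * \<eta> t \<partial>lebesgue_on {0..1})"
    and "integrable (lebesgue_on {0..1}) (\<lambda>t. g t * \<eta>' t)"
    and "integrable (lebesgue_on {0..1}) (\<lambda>t. v t * \<eta> t)"
proof -
  let ?M = "lebesgue_on {0..1::real}"
  note [measurable] = \<eta>'(1)
  have "continuous_on {0..1} \<eta>"
    by (rule absolutely_continuous_on_imp_continuous_on[OF lipschitz_imp_absolutely_continuous_on[OF lip]])
  then have [measurable]: "\<eta> \<in> borel_measurable ?M"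
    by (rule continuous_imp_measurable_on_sets_lebesgue) simp
  define K where "K = \<bar>\<eta> 0\<bar> + \<bar>B\<bar>"
  have K: "\<bar>\<eta> t\<bar> \<le> K" if t: "t \<in> {0..1}" for t
  proof -
    have "\<bar>\<eta> t - \<eta> 0\<bar> \<le> B * \<bar>t - 0\<bar>" by (rule lip) (use t in auto)
    also have "\<dots> \<le> \<bar>B\<bar> * 1" using t by (intro mult_mono) auto
    finally show ?thesis by (simp add: K_def)
  qed
  have K0: "0 \<le> K" by (simp add: K_def)
  show v\<eta>: "integrable ?M (\<lambda>t. v t * \<eta> t)"
  proof (rule bounded_measurable_integrable_on(2)[where B = "C * K"])
    show "\<bar>v t * \<eta> t\<bar> \<le> C * K" if "t \<in> {0..1}" for t
      unfolding abs_mult by (intro mult_mono v_bound K that C_nonneg) auto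
  qed measurable
  have u\<eta>: "integrable ?M (\<lambda>t. \<bar>u t\<bar> * (\<eta> t)\<^sup>2)"
  proof (rule bounded_measurable_integrable_on(2)[where B = "C * K\<^sup>2"])
    show "\<bar>\<bar>u t\<bar> * (\<eta> t)\<^sup>2\<bar> \<le> C * K\<^sup>2" if t: "t \<in> {0..1}" for t
    proof -
      have "(\<eta> t)\<^sup>2 \<le> K\<^sup>2" using power_mono[OF K[OF t], of 2] by simp
      then show ?thesis using u_bound[OF t] C_nonneg by (auto simp: abs_mult intro: mult_mono)
    qed
  qed measurable
  have \<eta>'2: "integrable ?M (\<lambda>t. (\<eta>' t)\<^sup>2)"
  proof (rule bounded_measurable_integrable_on(2)[where B = "B'\<^sup>2"])
    show "\<bar>(\<eta>' t)\<^sup>2\<bar> \<le> B'\<^sup>2" if "t \<in> {0..1}" for t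
      using power_mono[OF \<eta>'(2)[OF that], of 2] by simp
  qed measurable
  have up: "integrable ?M (\<lambda>t. u t * p t)"
  proof (rule bounded_measurable_integrable_on(2)[where B = C])
    show "\<bar>u t * p t\<bar> \<le> C" if t: "t \<in> {0..1}" for t
    proof -
      have "\<bar>u t * p t\<bar> \<le> C * 1"
        unfolding abs_mult using p_range[OF t] by (intro mult_mono u_bound t C_nonneg) auto
      then show ?thesis by simp
    qed
  qed measurable
  show g\<eta>': "integrable ?M (\<lambda>t. g t * \<eta>' t)"
  proof (rule measurable_bounded_by_integrable_imp_lebesgue_integrable[where g = "\<lambda>t. \<bar>g t\<bar> * B'"])
    show "integrable ?M (\<lambda>t. \<bar>g t\<bar> * B')" using g_integrable by simp
    show "norm (g t * \<eta>' t) \<le> \<bar>g t\<bar> * B'" if "t \<in> {0..1}" for t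
      using \<eta>'(2)[OF that] by (simp add: abs_mult mult_left_mono)
  qed (measurable, simp)
  define I1 where "I1 = (\<integral>t. g t * \<eta>' t \<partial>?M)"
  define I2 where "I2 = (\<integral>t. v t * \<eta> t \<partial>?M)"
  define I3 where "I3 = (\<integral>t. (\<eta>' t)\<^sup>2 \<partial>?M)"
  define I4 where "I4 = (\<integral>t. \<bar>u t\<bar> * (\<eta> t)\<^sup>2 \<partial>?M)"
  define I0 where "I0 = (\<integral>t. 4 * (g t)\<^sup>2 - u t * p t \<partial>?M)"
  have int0: "integrable ?M (\<lambda>t. 4 * (g t)\<^sup>2 - u t * p t)"
    by (intro Bochner_Integration.integrable_diff integrable_mult_right g_square_integrable up)
  have "0 \<le> e * (8 * I1 - I2) + e\<^sup>2 * (4 * I3 + 2 * I4)" for e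
  proof -
    define q where "q = (\<lambda>t. (sin (\<theta> t + e * \<eta> t))\<^sup>2)"
    \<comment> \<open>The square \<open>4 * (g t + e * \<eta>' t)\<^sup>2\<close> is expanded
      exactly; the term with \<open>\<bar>u t\<bar>\<close> absorbs the remainder of the reward,
      whatever the sign of \<open>u\<close>.\<close>
    define \<psi> where "\<psi> t = (4 * (g t)\<^sup>2 - u t * p t) + e * (8 * (g t * \<eta>' t) - v t * \<eta> t)
        + e\<^sup>2 * (4 * (\<eta>' t)\<^sup>2 + 2 * (\<bar>u t\<bar> * (\<eta> t)\<^sup>2))" for t
    have \<psi>: "integrable ?M \<psi>" unfolding \<psi>_def
      by (intro Bochner_Integration.integrable_add Bochner_Integration.integrable_diff integrable_mult_right g_square_integrable up g\<eta>' v\<eta> \<eta>'2 u\<eta>)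
    have int\<psi>: "integral\<^sup>L ?M \<psi> = I0 + e * (8 * I1 - I2) + e\<^sup>2 * (4 * I3 + 2 * I4)"
      unfolding \<psi>_def I0_def I1_def I2_def I3_def I4_def
      using int0 g\<eta>' v\<eta> \<eta>'2 u\<eta> by simp
    obtain N where N: "negligible N" "\<And>t. t \<in> {0..1} - N \<Longrightarrow> (\<theta> has_real_derivative g t) (at t within {0..1})"
      using derivatives_ae by blast
    have "AE t in ?M. cost_rate q t - ereal (u t * q t) \<le> ereal (\<psi> t)"
    proof (rule AE_lebesgue_onI[where N = "N \<union> N'"])
      show "negligible (N \<union> N')" using N(1) N'(1) by (rule negligible_Un)
      fix t assume t: "t \<in> {0..1} - (N \<union> N')"
      then have t01: "t \<in> {0..1}" by blast
      have "((\<lambda>t. \<theta> t + e * \<eta> t) has_real_derivative g t + e * \<eta>' t) (at t within {0..1})"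
        by (intro DERIV_add DERIV_cmult N(2) N'(2)) (use t in auto)
      then have "cost_rate q t \<le> ereal (4 * (g t + e * \<eta>' t)\<^sup>2)"
        unfolding q_def using t01 by (rule cost_rate_sin_square_le)
      moreover have "4 * (g t + e * \<eta>' t)\<^sup>2 - u t * q t \<le> \<psi> t"
      proof -
        define \<rho> where "\<rho> = q t - p t - e * \<eta> t * sin (2 * \<theta> t)"
        have "\<bar>\<rho>\<bar> \<le> 2 * (e * \<eta> t)\<^sup>2"
          unfolding \<rho>_def q_def p_eq[OF t01] by (rule sin_square_expansion)
        then have "\<bar>u t * \<rho>\<bar> \<le> \<bar>u t\<bar> * (2 * (e * \<eta> t)\<^sup>2)"
          unfolding abs_mult by (rule mult_left_mono) simp
        then have "- (u t * \<rho>) \<le> \<bar>u t\<bar> * (2 * (e * \<eta> t)\<^sup>2)" by linarith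
        moreover have "q t = p t + e * \<eta> t * sin (2 * \<theta> t) + \<rho>" by (simp add: \<rho>_def)
        ultimately show ?thesis
          unfolding \<psi>_def v_def by (simp add: algebra_simps power2_eq_square)
      qed
      ultimately have "cost_rate q t - ereal (u t * q t) \<le> ereal (4 * (g t + e * \<eta>' t)\<^sup>2) - ereal (u t * q t)"
        by (intro ereal_minus_mono) auto
      also have "\<dots> \<le> ereal (\<psi> t)" using \<open>4 * (g t + e * \<eta>' t)\<^sup>2 - u t * q t \<le> \<psi> t\<close> by simp
      finally show "cost_rate q t - ereal (u t * q t) \<le> ereal (\<psi> t)" .
    qed simp
    then have "J_P u q \<le> ereal_integral ?M (\<lambda>t. ereal (\<psi> t))"
      unfolding J_P_def by (rule ereal_integral_mono_AE)
    also have "\<dots> = ereal (integral\<^sup>L ?M \<psi>)" by (rule ereal_integral_eq[OF \<psi>]) simp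
    finally have "J_P u q \<le> ereal (integral\<^sup>L ?M \<psi>)" .
    moreover have "admissible q" unfolding q_def by (rule admissible_variation[OF lip])
    then have "J_P u p \<le> J_P u q" using optimal by (simp add: optimal_solution_def)
    ultimately have "I0 \<le> integral\<^sup>L ?M \<psi>" unfolding J_P_eq I0_def by (metis ereal_less_eq(3) order_trans)
    then show ?thesis unfolding int\<psi> by linarith
  qed
  then have "8 * I1 - I2 = 0" by (rule linear_term_zero)
  then show "8 * (\<integral>t. g t * \<eta>' t \<partial>?M) = (\<integral>t. v t * \<eta> t \<partial>?M)" by (simp add: I1_def I2_def)
qed

section \<open>Regularity of the angle\<close>

text \<open>The Euler-Lagrange equation integrated backwards from zero slope at 1, the natural
  boundary condition. It is Lipschitz by construction, whereas \<open>g\<close> is so far meaningful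
  only almost everywhere.\<close>

definition R :: "real \<Rightarrow> real" where "R t = integral {t..1} v / 8"

lemma v_integrable_subinterval: "{a..b} \<subseteq> {0..1} \<Longrightarrow> v integrable_on {a..b}"
  using integrable_subinterval_real[OF v_integrable] by blast

lemma integral_v_bound:
  assumes "0 \<le> x" "x \<le> y" "y \<le> 1"
  shows "\<bar>integral {x..y} v\<bar> \<le> C * (y - x)"
proof -
  have "{x..y} \<subseteq> {0..1}" using assms by auto
  then have "norm (integral {x..y} v) \<le> C * measure lborel {x..y}"
    by (intro has_integral_bound_real[OF C_nonneg finite.emptyI integrable_integral[OF v_integrable_subinterval]])
      (use v_bound in auto)
  then show ?thesis using assms by simp
qed

lemma R_diff:
  assumes "0 \<le> x" "x \<le> y" "y \<le> 1"
  shows "R y - R x = - integral {x..y} v / 8"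
  using Henstock_Kurzweil_Integration.integral_combine[of x y 1 v] v_integrable_subinterval[of x 1] assms
  by (simp add: R_def field_simps)

lemma R_lipschitz:
  assumes "x \<in> {0..1}" "y \<in> {0..1}"
  shows "\<bar>R y - R x\<bar> \<le> C * \<bar>y - x\<bar>"
proof -
  have *: "\<bar>R b - R a\<bar> \<le> C * (b - a)" if "0 \<le> a" "a \<le> b" "b \<le> 1" for a b
  proof -
    have "\<bar>R b - R a\<bar> \<le> C * (b - a) / 8" using integral_v_bound[OF that] R_diff[OF that] by simp
    also have "\<dots> \<le> C * (b - a)" using C_nonneg that by simp
    finally show ?thesis .
  qed
  show ?thesis using *[of x y] *[of y x] assms by (cases "x \<le> y") (auto simp: abs_minus_commute)
qed

lemma R_1: "R 1 = 0" by (simp add: R_def)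

text \<open>Natural boundary condition, from the constant variation.\<close>

lemma R_0: "R 0 = 0"
proof -
  have "8 * (\<integral>t. g t * 0 \<partial>lebesgue_on {0..1}) = (\<integral>t. v t * 1 \<partial>lebesgue_on {0..1})"
    by (rule first_variation(1)[where B = 0 and N' = "{}" and B' = 0 and \<eta>' = "\<lambda>_. 0"])
      (auto intro!: derivative_eq_intros)
  moreover have "integrable (lebesgue_on {0..1}) v"
    by (rule bounded_measurable_integrable_on(2)[OF v_meas v_bound])
  ultimately show ?thesis by (simp add: R_def lebesgue_integral_eq_integral)
qed

text \<open>Testing with a ramp from \<open>0\<close> to \<open>1\<close> over \<open>[a, a + h]\<close> expresses the difference quotient of
  \<open>\<theta>\<close> as an integral of \<open>v\<close>, so that no fundamental lemma of the calculus of variations is needed.\<close>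

lemma theta_increment:
  assumes ah: "0 \<le> a" "0 < h" "a + h \<le> 1"
  shows "\<bar>\<theta> (a + h) - \<theta> a - h * R a\<bar> \<le> C * h\<^sup>2"
proof -
  let ?M = "lebesgue_on {0..1::real}"
  define \<eta> where "\<eta> t = max 0 (min 1 ((t - a) / h))" for t
  define \<eta>' where "\<eta>' t = (if t \<in> {a..a + h} then 1 / h else 0)" for t
  have lip: "\<bar>\<eta> y - \<eta> x\<bar> \<le> (1 / h) * \<bar>y - x\<bar>" for x y
  proof -
    have "\<bar>\<eta> y - \<eta> x\<bar> \<le> \<bar>(y - a) / h - (x - a) / h\<bar>" unfolding \<eta>_def by (auto simp: max_def min_def)
    also have "\<dots> = \<bar>(y - x) / h\<bar>" by (simp add: diff_divide_distrib)
    also have "\<dots> = (1 / h) * \<bar>y - x\<bar>" using ah by (simp add: abs_divide)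
    finally show ?thesis .
  qed
  have \<eta>_cases: "t \<le> a \<Longrightarrow> \<eta> t = 0" "a + h \<le> t \<Longrightarrow> \<eta> t = 1"
    "a \<le> t \<Longrightarrow> t \<le> a + h \<Longrightarrow> \<eta> t = (t - a) / h" for t
    using ah by (auto simp: \<eta>_def max_def min_def field_simps)
  have der: "(\<eta> has_real_derivative \<eta>' t) (at t within {0..1})" if t: "t \<in> {0..1} - {a, a + h}" for t
  proof -
    consider "t < a" | "a < t" "t < a + h" | "a + h < t" using t by fastforce
    then have "(\<eta> has_real_derivative \<eta>' t) (at t)"
    proof cases
      case 1
      have "((\<lambda>_. 0) has_real_derivative 0) (at t)" by simp
      then have "(\<eta> has_real_derivative 0) (at t)"
        by (rule has_field_derivative_transform_within_open[of _ _ _ "{..<a}"]) (use 1 \<eta>_cases in auto)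
      then show ?thesis using 1 by (simp add: \<eta>'_def)
    next
      case 2
      have "((\<lambda>t. (t - a) / h) has_real_derivative 1 / h) (at t)"
        using ah by (auto intro!: derivative_eq_intros)
      then have "(\<eta> has_real_derivative 1 / h) (at t)"
        by (rule has_field_derivative_transform_within_open[of _ _ _ "{a<..<a + h}"]) (use 2 \<eta>_cases in auto)
      then show ?thesis using 2 by (simp add: \<eta>'_def)
    next
      case 3
      have "((\<lambda>_. 1) has_real_derivative 0) (at t)" by simp
      then have "(\<eta> has_real_derivative 0) (at t)"
        by (rule has_field_derivative_transform_within_open[of _ _ _ "{a + h<..}"]) (use 3 \<eta>_cases in auto)
      then show ?thesis using 3 by (simp add: \<eta>'_def)
    qed
    then show ?thesis by (rule has_field_derivative_at_within)
  qed
  have \<eta>'_meas: "\<eta>' \<in> borel_measurable ?M"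
  proof -
    have "\<eta>' \<in> borel_measurable borel" unfolding \<eta>'_def by measurable
    then have "\<eta>' \<in> borel_measurable lebesgue" by (simp add: measurable_completion)
    then show ?thesis by (rule measurable_restrict_space1)
  qed
  have \<eta>'_bound: "\<bar>\<eta>' t\<bar> \<le> 1 / h" for t using ah by (simp add: \<eta>'_def)
  have neg: "negligible {a, a + h}" by simp
  note fv = first_variation[OF lip neg der \<eta>'_meas \<eta>'_bound]
  have sub: "{a..a + h} \<subseteq> {0..1}" "{a..1} \<subseteq> {0..1}" using ah by auto
  \<comment> \<open>Against the slope of the ramp, \<open>g\<close> integrates to the difference
    quotient of \<open>\<theta>\<close>.\<close>
  have "((\<lambda>t. (1 / h) * g t) has_integral (1 / h) * (\<theta> (a + h) - \<theta> a)) {a..a + h}"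
    by (intro has_integral_mult_right theta_FTC) (use ah in auto)
  then have "((\<lambda>t. if t \<in> {a..a + h} then (1 / h) * g t else 0) has_integral (1 / h) * (\<theta> (a + h) - \<theta> a)) {0..1}"
    using sub by (simp only: has_integral_restrict)
  moreover have "(\<lambda>t. if t \<in> {a..a + h} then (1 / h) * g t else 0) = (\<lambda>t. g t * \<eta>' t)"
    by (auto simp: \<eta>'_def)
  ultimately have "integral {0..1} (\<lambda>t. g t * \<eta>' t) = (1 / h) * (\<theta> (a + h) - \<theta> a)"
    by (simp only: integral_unique)
  moreover have "integral\<^sup>L ?M (\<lambda>t. g t * \<eta>' t) = integral {0..1} (\<lambda>t. g t * \<eta>' t)"
    by (rule lebesgue_integral_eq_integral[OF fv(2)]) auto
  moreover have "integral\<^sup>L ?M (\<lambda>t. v t * \<eta> t) = integral {0..1} (\<lambda>t. v t * \<eta> t)"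
    by (rule lebesgue_integral_eq_integral[OF fv(3)]) auto
  ultimately have "8 * ((1 / h) * (\<theta> (a + h) - \<theta> a)) = integral {0..1} (\<lambda>t. v t * \<eta> t)"
    using fv(1) by simp
  then have eq: "\<theta> (a + h) - \<theta> a = h * integral {0..1} (\<lambda>t. v t * \<eta> t) / 8"
    using ah by (simp add: field_simps)
  have v1: "((\<lambda>t. if t \<in> {a..1} then v t else 0) has_integral integral {a..1} v) {0..1}"
    using sub by (simp only: has_integral_restrict) (rule integrable_integral[OF v_integrable_subinterval])
  have v\<eta>: "((\<lambda>t. v t * \<eta> t) has_integral integral {0..1} (\<lambda>t. v t * \<eta> t)) {0..1}"
    by (rule integrable_integral[OF integrable_on_lebesgue_on[OF fv(3)]]) auto
  have "((\<lambda>t. C) has_integral C * h) {a..a + h}"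
    using has_integral_const_real[of C a "a + h"] ah by (simp add: mult.commute)
  then have c: "((\<lambda>t. if t \<in> {a..a + h} then C else 0) has_integral C * h) {0..1}"
    using sub by (simp only: has_integral_restrict)
  \<comment> \<open>\<open>\<eta>\<close> differs from the indicator of \<open>[a, 1]\<close> only
    on the ramp, where the integrand deviates by at most \<open>C\<close>.\<close>
  have "norm (integral {0..1} (\<lambda>t. v t * \<eta> t) - integral {a..1} v) \<le> C * h"
  proof -
    have "norm (integral {0..1} (\<lambda>t. v t * \<eta> t - (if t \<in> {a..1} then v t else 0)))
        \<le> integral {0..1} (\<lambda>t. if t \<in> {a..a + h} then C else 0)"
    proof (rule integral_norm_bound_integral)
      fix t :: real assume t: "t \<in> {0..1}"
      have "\<bar>v t * \<eta> t - v t\<bar> \<le> C" if "a \<le> t" "t \<le> a + h"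
      proof -
        have "0 \<le> 1 - \<eta> t" "1 - \<eta> t \<le> 1" by (auto simp: \<eta>_def)
        then have "\<bar>v t\<bar> * \<bar>1 - \<eta> t\<bar> \<le> C * 1" by (intro mult_mono v_bound t C_nonneg) auto
        moreover have "v t * \<eta> t - v t = - (v t * (1 - \<eta> t))" by (simp add: algebra_simps)
        ultimately show ?thesis by (simp add: abs_mult)
      qed
      then show "norm (v t * \<eta> t - (if t \<in> {a..1} then v t else 0)) \<le> (if t \<in> {a..a + h} then C else 0)"
        using t \<eta>_cases(1,2)[of t] ah by auto
    qed (use has_integral_diff[OF v\<eta> v1] c in \<open>auto simp: integrable_on_def\<close>)
    then show "norm (integral {0..1} (\<lambda>t. v t * \<eta> t) - integral {a..1} v) \<le> C * h"
      unfolding integral_unique[OF has_integral_diff[OF v\<eta> v1]] integral_unique[OF c] .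
  qed
  then have bound: "\<bar>integral {0..1} (\<lambda>t. v t * \<eta> t) - integral {a..1} v\<bar> \<le> C * h" by simp
  have "\<theta> (a + h) - \<theta> a - h * R a = h / 8 * (integral {0..1} (\<lambda>t. v t * \<eta> t) - integral {a..1} v)"
    unfolding eq R_def by (simp add: algebra_simps)
  also have "\<bar>\<dots>\<bar> \<le> h / 8 * (C * h)"
    unfolding abs_mult using bound ah by (intro mult_mono) auto
  also have "\<dots> \<le> C * h\<^sup>2" using C_nonneg ah by (simp add: power2_eq_square)
  finally show ?thesis .
qed

text \<open>\<open>theta_increment\<close> only looks forward. For \<open>y < t\<close> it starts at
  \<open>y\<close> and yields \<open>R y\<close>; the Lipschitz bound exchanges this for
  \<open>R t\<close>, at the price of the second \<open>C\<close>.\<close>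

lemma theta_derivative:
  assumes t: "t \<in> {0..1}"
  shows "(\<theta> has_real_derivative R t) (at t within {0..1})"
proof (rule has_real_derivative_quadratic_bound[where C = "2 * C"])
  fix y :: real assume y: "y \<in> {0..1}"
  consider "y = t" | "t < y" | "y < t" by linarith
  then show "\<bar>\<theta> y - \<theta> t - (y - t) * R t\<bar> \<le> 2 * C * (y - t)\<^sup>2"
  proof cases
    case 2
    have "\<bar>\<theta> y - \<theta> t - (y - t) * R t\<bar> \<le> C * (y - t)\<^sup>2"
      using theta_increment[of t "y - t"] 2 t y by simp
    also have "\<dots> \<le> 2 * C * (y - t)\<^sup>2" using C_nonneg by (intro mult_right_mono) auto
    finally show ?thesis .
  next
    case 3
    have 1: "\<bar>\<theta> t - \<theta> y - (t - y) * R y\<bar> \<le> C * (t - y)\<^sup>2"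
      using theta_increment[of y "t - y"] 3 t y by simp
    have "\<bar>(t - y) * (R t - R y)\<bar> \<le> (t - y) * (C * \<bar>t - y\<bar>)"
      unfolding abs_mult using R_lipschitz[OF y t] 3 by (intro mult_mono) auto
    then have 2: "\<bar>(t - y) * (R t - R y)\<bar> \<le> C * (t - y)\<^sup>2" using 3 by (simp add: power2_eq_square mult_ac)
    have "\<theta> y - \<theta> t - (y - t) * R t = (t - y) * (R t - R y) - (\<theta> t - \<theta> y - (t - y) * R y)"
      by (simp add: algebra_simps)
    then have "\<bar>\<theta> y - \<theta> t - (y - t) * R t\<bar> \<le> 2 * (C * (t - y)\<^sup>2)" using 1 2 by linarith
    then show ?thesis by (simp add: power2_commute)
  qed simp
qed

section \<open>The sign of the second derivative\<close>

definition rate :: "real \<Rightarrow> real" where "rate t = R t * sin (2 * \<theta> t)"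

text \<open>The derivative of \<open>rate\<close>, i.e. \<open>p''\<close>, is \<open>(sin (2 \<theta>))\<^sup>2 / 8 * (threshold - u)\<close>.\<close>

definition threshold :: "real \<Rightarrow> real" where
  "threshold t = 16 * cos (2 * \<theta> t) * (R t)\<^sup>2 / (sin (2 * \<theta> t))\<^sup>2"

lemma p_has_derivative:
  assumes t: "t \<in> {0..1}"
  shows "(p has_real_derivative rate t) (at t within {0..1})"
proof -
  have "((\<lambda>t. (sin (\<theta> t))\<^sup>2) has_real_derivative 2 * sin (\<theta> t) * (cos (\<theta> t) * R t)) (at t within {0..1})"
    by (rule derivative_eq_intros theta_derivative[OF t] refl)+ simp
  also have "2 * sin (\<theta> t) * (cos (\<theta> t) * R t) = rate t" by (simp add: rate_def sin_double)
  finally have "((\<lambda>t. (sin (\<theta> t))\<^sup>2) has_real_derivative rate t) (at t within {0..1})" .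
  then show ?thesis
    by (rule has_field_derivative_transform_within[OF _ zero_less_one t]) (simp add: p_eq)
qed

lemma deriv01_p: "t \<in> {0..1} \<Longrightarrow> deriv01 p t = rate t"
  by (rule deriv01_eq[OF p_has_derivative])

text \<open>The set \<open>{a..1}\<close> serves two uses: \<open>a = 0\<close> where
  \<open>u\<close> is continuous within \<open>[0, 1]\<close>, and \<open>a = t\<close> for a right
  derivative where \<open>u\<close> is only known to be continuous from the right.\<close>

lemma R_has_derivative:
  assumes a: "0 \<le> a" and t: "t \<in> {a..1}" and u: "continuous (at t within {a..1}) u"
  shows "(R has_real_derivative - v t / 8) (at t within {a..1})"
proof -
  have sub: "{a..1} \<subseteq> {0..1}" using a by auto
  have "continuous_on {a..1} \<theta>" by (rule continuous_on_subset[OF theta_cont sub])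
  then have "continuous (at t within {a..1}) \<theta>" using t by (simp add: continuous_on_eq_continuous_within)
  then have "continuous (at t within {a..1}) v"
    unfolding v_def by (intro continuous_intros u)
  then have "((\<lambda>y. integral {a..y} v) has_vector_derivative v t) (at t within {a..1})"
    using integral_has_vector_derivative_continuous_at[OF v_integrable_subinterval[OF sub], of t "{}"] t by simp
  then have "((\<lambda>y. integral {a..y} v) has_real_derivative v t) (at t within {a..1})"
    by (simp add: has_real_derivative_iff_has_vector_derivative)
  then have "((\<lambda>y. R a - integral {a..y} v / 8) has_real_derivative - v t / 8) (at t within {a..1})"
    by (auto intro!: derivative_eq_intros)
  then show ?thesis
  proof (rule has_field_derivative_transform_within[OF _ zero_less_one t])
    show "R a - integral {a..y} v / 8 = R y" if "y \<in> {a..1}" for y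
      using R_diff[of a y] a that by simp
  qed
qed

lemma R_cont: "continuous_on {0..1} R"
  by (rule absolutely_continuous_on_imp_continuous_on[OF lipschitz_imp_absolutely_continuous_on[OF R_lipschitz]])

lemma threshold_cont: "continuous_on {0..1} threshold"
  unfolding threshold_def using sin_2theta_pos
  by (intro continuous_intros theta_cont R_cont) (metis less_irrefl power_not_zero)

lemma R_bound: "t \<in> {0..1} \<Longrightarrow> \<bar>R t\<bar> \<le> C"
proof -
  assume t: "t \<in> {0..1}"
  have "\<bar>R 1 - R t\<bar> \<le> C * \<bar>1 - t\<bar>" by (rule R_lipschitz) (use t in auto)
  also have "\<dots> \<le> C * 1" using t C_nonneg by (intro mult_left_mono) auto
  finally show ?thesis by (simp add: R_1)
qed

text \<open>\<open>R\<close> is Lipschitz and \<open>\<theta>\<close> absolutely continuous. Since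
  \<open>u\<close> may jump, the derivative of \<open>rate\<close> is available only almost
  everywhere, and absolute continuity is what recovers its increments from it.\<close>

lemma rate_AC: "absolutely_continuous_on {0..1} rate"
proof (rule absolutely_continuous_on_dominated[OF theta_AC, of _ "2 * C" C])
  fix x y :: real assume xy: "x \<in> {0..1}" "y \<in> {0..1}"
  have lip: "\<bar>sin b - sin a\<bar> \<le> \<bar>b - a\<bar>" for a b :: real
  proof -
    have "norm (sin b - sin a) \<le> 1 * norm (b - a)"
      by (rule field_differentiable_bound[where S = UNIV and f = sin and f' = cos])
        (auto intro: DERIV_sin)
    then show ?thesis by simp
  qed
  have eq: "rate y - rate x = (R y - R x) * sin (2 * \<theta> y) + R x * (sin (2 * \<theta> y) - sin (2 * \<theta> x))"
    by (simp add: rate_def algebra_simps)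
  have 1: "\<bar>(R y - R x) * sin (2 * \<theta> y)\<bar> \<le> (C * \<bar>y - x\<bar>) * 1"
    unfolding abs_mult using C_nonneg by (intro mult_mono R_lipschitz xy) auto
  have "\<bar>sin (2 * \<theta> y) - sin (2 * \<theta> x)\<bar> \<le> \<bar>2 * (\<theta> y - \<theta> x)\<bar>"
    unfolding right_diff_distrib by (rule lip)
  then have "\<bar>sin (2 * \<theta> y) - sin (2 * \<theta> x)\<bar> \<le> 2 * \<bar>\<theta> y - \<theta> x\<bar>" by (simp only: abs_mult abs_numeral)
  then have 2: "\<bar>R x * (sin (2 * \<theta> y) - sin (2 * \<theta> x))\<bar> \<le> C * (2 * \<bar>\<theta> y - \<theta> x\<bar>)"
    unfolding abs_mult by (intro mult_mono R_bound xy C_nonneg) auto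
  show "\<bar>rate y - rate x\<bar> \<le> 2 * C * \<bar>\<theta> y - \<theta> x\<bar> + C * \<bar>y - x\<bar>"
    unfolding eq using 1 2 by linarith
qed

lemma rate_integral:
  assumes xy: "0 \<le> x" "x \<le> y" "y \<le> 1"
  shows "((\<lambda>t. (sin (2 * \<theta> t))\<^sup>2 / 8 * (threshold t - u t)) has_integral (rate y - rate x)) {x..y}"
proof -
  \<comment> \<open>A monotone function has countably many discontinuities, so this set is
    null.\<close>
  define N where "N = {t \<in> {0..1}. \<not> continuous (at t within {0..1}) u}"
  have N: "negligible N"
    unfolding N_def negligible_iff_null_sets
    by (intro null_sets_completionI countable_imp_null_set_lborel mono_on_ctble_discont mono_u)
  have sub: "{x..y} \<subseteq> {0..1}" using xy by auto
  show ?thesis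
  proof (rule fundamental_theorem_of_calculus_absolutely_continuous[OF _ xy(2) N])
    show "absolutely_continuous_on {x..y} rate" by (rule absolutely_continuous_on_subset[OF rate_AC sub])
    fix t assume "t \<in> {x..y} - N"
    then have t: "t \<in> {0..1}" and u: "continuous (at t within {0..1}) u" using sub by (auto simp: N_def)
    have S: "sin (2 * \<theta> t) \<noteq> 0" using sin_2theta_pos[OF t] by simp
    have "(R has_real_derivative - v t / 8) (at t within {0..1})"
      by (rule R_has_derivative[OF order_refl t u])
    then have "(rate has_real_derivative - v t / 8 * sin (2 * \<theta> t) + R t * (cos (2 * \<theta> t) * (2 * R t))) (at t within {0..1})"
      unfolding rate_def by (auto intro!: derivative_eq_intros theta_derivative[OF t])
    \<comment> \<open>Factoring out \<open>(sin (2 * \<theta> t))\<^sup>2 / 8\<close>, the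
      coefficient of \<open>- u t\<close>, turns the other term into
      \<open>threshold t\<close>.\<close>
    also have "- v t / 8 * sin (2 * \<theta> t) + R t * (cos (2 * \<theta> t) * (2 * R t)) = (sin (2 * \<theta> t))\<^sup>2 / 8 * (threshold t - u t)"
      using S by (simp add: threshold_def v_def power2_eq_square field_simps)
    finally show "(rate has_real_derivative (sin (2 * \<theta> t))\<^sup>2 / 8 * (threshold t - u t)) (at t within {x..y})"
      using sub by (rule has_field_derivative_subset)
  qed
qed

text \<open>The sign is required only strictly between \<open>x\<close> and \<open>y\<close>, since
  \<open>sigmoidal_p\<close> compares \<open>threshold\<close> with \<open>u\<close> only in the
  open unit interval.\<close>

lemma rate_mono:
  assumes xy: "0 \<le> x" "x \<le> y" "y \<le> 1" and "\<And>t. x < t \<Longrightarrow> t < y \<Longrightarrow> u t \<le> threshold t"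
  shows "rate x \<le> rate y"
proof -
  have "((\<lambda>t. (sin (2 * \<theta> t))\<^sup>2 / 8 * (threshold t - u t)) has_integral (rate y - rate x)) {x<..<y}"
    using rate_integral[OF xy] by (simp add: has_integral_Icc_iff_Ioo)
  then have "0 \<le> rate y - rate x"
    by (rule has_integral_nonneg) (use assms(4) in \<open>auto intro!: mult_nonneg_nonneg\<close>)
  then show ?thesis by simp
qed

lemma rate_antimono:
  assumes xy: "0 \<le> x" "x \<le> y" "y \<le> 1" and "\<And>t. x < t \<Longrightarrow> t < y \<Longrightarrow> threshold t \<le> u t"
  shows "rate y \<le> rate x"
proof -
  have "((\<lambda>t. - ((sin (2 * \<theta> t))\<^sup>2 / 8 * (threshold t - u t))) has_integral - (rate y - rate x)) {x<..<y}"
    using has_integral_neg[OF rate_integral[OF xy]] by (simp only: has_integral_Icc_iff_Ioo)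
  then have "0 \<le> - (rate y - rate x)"
    by (rule has_integral_nonneg) (use assms(4) in \<open>auto simp: mult_nonneg_nonpos\<close>)
  then show ?thesis by simp
qed

section \<open>Positivity of the angular speed and the crossing argument\<close>

lemma sin_2theta_lower_bound:
  obtains m where "0 < m" "\<And>t. t \<in> {0..1} \<Longrightarrow> m \<le> sin (2 * \<theta> t)"
proof -
  have "continuous_on {0..1} (\<lambda>t. sin (2 * \<theta> t))" by (intro continuous_intros theta_cont)
  then obtain a where "a \<in> {0..1}" "\<And>t. t \<in> {0..1} \<Longrightarrow> sin (2 * \<theta> a) \<le> sin (2 * \<theta> t)"
    using continuous_attains_inf[of "{0..1}" "\<lambda>t. sin (2 * \<theta> t)"] by fastforce
  then show thesis using that sin_2theta_pos by blast
qed

text \<open>\<open>v\<close> has the sign of \<open>u\<close>. Left of the crossing,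
  \<open>R t\<close> is minus one eighth of the integral of \<open>v\<close> over
  \<open>[0, t]\<close>, because \<open>R 0 = 0\<close>; from the crossing on it is one eighth of
  the integral over \<open>[t, 1]\<close>.\<close>

lemma R_pos:
  assumes sc: "single_crossing u" and t: "0 < t" "t < 1"
  shows "0 < R t"
proof -
  obtain m where m: "0 < m" "\<And>t. t \<in> {0..1} \<Longrightarrow> m \<le> sin (2 * \<theta> t)"
    using sin_2theta_lower_bound by blast
  obtain t\<^sub>u where tu: "t\<^sub>u \<in> {0..1}" "\<And>t. 0 \<le> t \<Longrightarrow> t < t\<^sub>u \<Longrightarrow> u t < 0" "\<And>t. t\<^sub>u < t \<Longrightarrow> t \<le> 1 \<Longrightarrow> 0 < u t"
    using sc unfolding single_crossing_def by auto
  show ?thesis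
  proof (cases "t < t\<^sub>u")
    case True
    have ut: "u t < 0" using tu(2) True t by simp
    have "integral {0..t} v \<le> integral {0..t} (\<lambda>_. u t * m)"
    proof (rule integral_le)
      show "v integrable_on {0..t}" by (rule v_integrable_subinterval) (use t in auto)
      fix s assume s: "s \<in> {0..t}"
      have "u s \<le> u t" using s t by (intro mono_onD[OF mono_u]) auto
      then have "v s \<le> u t * sin (2 * \<theta> s)"
        unfolding v_def using sin_2theta_pos[of s] s t by (intro mult_right_mono) auto
      also have "\<dots> \<le> u t * m" using ut m(2)[of s] s t by (intro mult_left_mono_neg) auto
      finally show "v s \<le> u t * m" .
    qed (rule integrable_const_ivl)
    also have "\<dots> = t * (u t * m)" using t by simp
    also have "\<dots> < 0" using ut m t by (simp add: mult_pos_neg mult_neg_pos)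
    finally have "integral {0..t} v < 0" .
    then show ?thesis using R_diff[of 0 t] t R_0 by simp
  next
    case False
    \<comment> \<open>\<open>t\<close> may be the crossing point, near which \<open>u\<close> may be
      arbitrarily small; strictness is obtained on \<open>[c, 1]\<close>, where \<open>u\<close> is
      at least \<open>u c > 0\<close>.\<close>
    define c where "c = (t + 1) / 2"
    have c: "t < c" "c < 1" using t by (auto simp: c_def)
    have uc: "0 < u c" using tu(3)[of c] c False by simp
    have "0 \<le> integral {t<..<c} v"
    proof (rule integral_nonneg)
      show "v integrable_on {t<..<c}"
        using v_integrable_subinterval[of t c] t c by (simp add: integrable_on_Icc_iff_Ioo)
      show "0 \<le> v s" if "s \<in> {t<..<c}" for s
        unfolding v_def using tu(3)[of s] sin_2theta_pos[of s] that c t False by simp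
    qed
    then have 1: "0 \<le> integral {t..c} v" by (simp add: integral_open_interval_real)
    have "0 < (1 - c) * (u c * m)" using uc m c by simp
    also have "\<dots> = integral {c..1} (\<lambda>_. u c * m)" using c by simp
    also have "\<dots> \<le> integral {c..1} v"
    proof (rule integral_le)
      show "v integrable_on {c..1}" by (rule v_integrable_subinterval) (use t c in auto)
      fix s assume s: "s \<in> {c..1}"
      have us: "u c \<le> u s" using s t c by (intro mono_onD[OF mono_u]) auto
      then show "u c * m \<le> v s"
        unfolding v_def using m(2)[of s] m(1) uc s t c by (intro mult_mono) auto
    qed (rule integrable_const_ivl)
    finally have 2: "0 < integral {c..1} v" .
    have "R t = (integral {t..c} v + integral {c..1} v) / 8"
      using R_diff[of t c] t c by (simp add: R_def field_simps)
    then show ?thesis using 1 2 by simp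
  qed
qed

text \<open>Where \<open>threshold\<close> would overtake \<open>u\<close> again the two agree and \<open>u\<close> is continuous from the
  right. The Euler-Lagrange equation then gives \<open>threshold\<close> a negative right derivative there,
  although it has to exceed the non-decreasing \<open>u\<close>.\<close>

lemma threshold_crossing:
  assumes sc: "single_crossing u" and t: "0 < t1" "t1 < t2" "t2 < 1" and t1: "threshold t1 \<le> u t1"
  shows "threshold t2 \<le> u t2"
proof (rule ccontr)
  assume "\<not> threshold t2 \<le> u t2"
  \<comment> \<open>The supremum \<open>s\<close> of this set will be the last time up to
    \<open>t2\<close> at which \<open>threshold\<close> does not exceed \<open>u\<close>.\<close>
  define T where "T = {t \<in> {t1..t2}. threshold t \<le> u t}"
  define s where "s = Sup T"
  have T: "t1 \<in> T" "bdd_above T" using t t1 by (auto simp: T_def)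
  have s: "t1 \<le> s" "s \<le> t2"
  proof -
    show "t1 \<le> s" unfolding s_def by (rule cSup_upper[OF T])
    show "s \<le> t2" unfolding s_def using T(1) by (intro cSup_least) (auto simp: T_def)
  qed
  have s01: "s \<in> {0..1}" using s t by auto
  \<comment> \<open>\<open>u\<close> cannot drop on the way to \<open>s\<close>, so
    \<open>threshold r \<le> u r \<le> u s\<close> for \<open>r\<close> in \<open>T\<close>, and
    continuity of \<open>threshold\<close> carries this over to \<open>s\<close>.\<close>
  have th_s: "threshold s \<le> u s"
  proof (rule ccontr)
    assume "\<not> threshold s \<le> u s"
    then have "0 < threshold s - u s" by simp
    then obtain d where d: "0 < d" "\<And>t. t \<in> {0..1} \<Longrightarrow> dist t s < d \<Longrightarrow> dist (threshold t) (threshold s) < threshold s - u s"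
      using threshold_cont s01 unfolding continuous_on_iff by blast
    have "s - d < Sup T" using d(1) by (simp add: s_def)
    then obtain r where r: "r \<in> T" "s - d < r" using less_cSupD[of T] T(1) by blast
    have rs: "r \<le> s" using cSup_upper[OF r(1) T(2)] by (simp add: s_def)
    have r01: "r \<in> {0..1}" using r(1) t by (auto simp: T_def)
    have "u r \<le> u s" using rs by (intro mono_onD[OF mono_u] r01 s01)
    moreover have "threshold r \<le> u r" using r(1) by (simp add: T_def)
    moreover have "dist (threshold r) (threshold s) < threshold s - u s"
      using d(2)[OF r01] r(2) rs by (simp add: dist_real_def)
    ultimately show False by (simp add: dist_real_def)
  qed
  then have st2: "s < t2" using \<open>\<not> threshold t2 \<le> u t2\<close> s by (cases "s = t2") auto
  have above: "u s \<le> u r" "u r < threshold r" if r: "s < r" "r \<le> t2" for r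
  proof -
    have "r \<notin> T" using cSup_upper[OF _ T(2), of r] r(1) by (auto simp: s_def)
    then show "u r < threshold r" using r s by (auto simp: T_def)
    show "u s \<le> u r" using r s t by (intro mono_onD[OF mono_u]) auto
  qed
  have sub: "{s..1} \<subseteq> {0..1}" using s01 by auto
  have th_lim: "(threshold \<longlongrightarrow> threshold s) (at s within {s..1})"
    using continuous_on_subset[OF threshold_cont sub] s01 by (simp add: continuous_on)
  have ev: "\<forall>\<^sub>F r in at s within {s..1}. s < r \<and> r \<le> t2"
    unfolding eventually_at using st2 by (intro exI[of _ "t2 - s"]) (auto simp: dist_real_def)
  have nontriv: "at s within {s..1} \<noteq> bot"
    using s t st2 by (simp add: trivial_limit_within islimpt_Icc)
  have "u s \<le> threshold s"
    by (rule tendsto_lowerbound[OF th_lim _ nontriv])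
      (use ev in \<open>eventually_elim, meson above less_imp_le order_trans\<close>)
  with th_s have eq: "threshold s = u s" by simp
  \<comment> \<open>Right of \<open>s\<close>, \<open>u\<close> is squeezed between
    \<open>u s\<close> and \<open>threshold\<close>, which tends to the same value.\<close>
  have "(u \<longlongrightarrow> u s) (at s within {s..1})"
  proof (rule tendsto_sandwich[OF _ _ tendsto_const th_lim[unfolded eq]])
    show "\<forall>\<^sub>F r in at s within {s..1}. u s \<le> u r" using ev by eventually_elim (simp add: above)
    show "\<forall>\<^sub>F r in at s within {s..1}. u r \<le> threshold r" using ev by eventually_elim (simp add: above less_imp_le)
  qed
  then have u_cont: "continuous (at s within {s..1}) u" by (simp add: continuous_within)
  have ss: "s \<in> {s..1}" using s01 by simp
  have R': "(R has_real_derivative - v s / 8) (at s within {s..1})"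
    using s01 by (intro R_has_derivative ss u_cont) simp
  have \<theta>': "(\<theta> has_real_derivative R s) (at s within {s..1})"
    by (rule has_field_derivative_subset[OF theta_derivative[OF s01] sub])
  define S c where "S = sin (2 * \<theta> s)" and "c = cos (2 * \<theta> s)"
  have S: "0 < S" using sin_2theta_pos[OF s01] by (simp add: S_def)
  have Rs: "0 < R s" using s st2 t by (intro R_pos[OF sc]) auto
  have us: "u s = 16 * c * (R s)\<^sup>2 / S\<^sup>2" using eq by (simp add: threshold_def c_def S_def)
  have vs: "- v s / 8 = - 2 * c * (R s)\<^sup>2 / S"
    unfolding v_def us S_def[symmetric] using S by (simp add: power2_eq_square field_simps)
  have "(threshold has_real_derivative
      ((16 * (- S * (2 * R s)) * (R s)\<^sup>2 + 16 * c * (2 * R s * (- v s / 8))) * S\<^sup>2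
        - 16 * c * (R s)\<^sup>2 * (2 * S * (c * (2 * R s)))) / (S\<^sup>2 * S\<^sup>2)) (at s within {s..1})"
    unfolding threshold_def
    by (rule derivative_eq_intros \<theta>' R' refl | (use S in \<open>simp add: S_def c_def\<close>; fail))+
  \<comment> \<open>The 128 is made up of 64 from \<open>R'\<close> after eliminating
    \<open>u s\<close>, and 64 from differentiating the denominator.\<close>
  also have "((16 * (- S * (2 * R s)) * (R s)\<^sup>2 + 16 * c * (2 * R s * (- v s / 8))) * S\<^sup>2
        - 16 * c * (R s)\<^sup>2 * (2 * S * (c * (2 * R s)))) / (S\<^sup>2 * S\<^sup>2)
      = - (32 * (R s)^3 / S + 128 * c\<^sup>2 * (R s)^3 / S^3)"
    unfolding vs using S by (simp add: field_simps power2_eq_square power3_eq_cube)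
  finally have "(threshold has_real_derivative - (32 * (R s)^3 / S + 128 * c\<^sup>2 * (R s)^3 / S^3)) (at s within {s..1})" .
  moreover have "- (32 * (R s)^3 / S + 128 * c\<^sup>2 * (R s)^3 / S^3) < 0"
  proof -
    have "0 < 32 * (R s)^3 / S" using Rs S by simp
    moreover have "0 \<le> 128 * c\<^sup>2 * (R s)^3 / S^3" using Rs S by simp
    ultimately show ?thesis by linarith
  qed
  ultimately obtain d where d: "0 < d" "\<And>h. 0 < h \<Longrightarrow> s + h \<in> {s..1} \<Longrightarrow> h < d \<Longrightarrow> threshold (s + h) < threshold s"
    using has_real_derivative_neg_dec_right by meson
  define h where "h = min (d / 2) (t2 - s)"
  have h: "0 < h" "h < d" "s + h \<le> t2" using d(1) st2 by (auto simp: h_def min_def)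
  have "threshold (s + h) < threshold s" using d(2)[of h] h t by simp
  moreover have "u s < threshold (s + h)" using above[of "s + h"] h by simp
  ultimately show False using eq by simp
qed

text \<open>By \<open>threshold_crossing\<close>, \<open>T\<close> contains every point of
  \<open>(0, 1)\<close> to the right of any of its members, so \<open>threshold - u\<close> changes
  sign at its infimum. The values of \<open>rate\<close> at 0, 1/2 and 1 keep that infimum
  inside.\<close>

lemma sigmoidal_p:
  assumes sc: "single_crossing u"
  shows "sigmoidal p"
proof -
  define T where "T = {t \<in> {0<..<1}. threshold t \<le> u t}"
  define \<tau> where "\<tau> = Inf T"
  have r0: "rate 0 = 0" "rate 1 = 0" by (simp_all add: rate_def R_0 R_1)
  have half: "0 < rate (1 / 2)"
    unfolding rate_def using R_pos[OF sc, of "1 / 2"] sin_2theta_pos[of "1 / 2"] by simp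
  \<comment> \<open>Otherwise \<open>rate\<close> would be non-decreasing on
    \<open>[1/2, 1]\<close>, from a positive value to 0.\<close>
  have "T \<noteq> {}"
  proof
    assume T: "T = {}"
    have "rate (1 / 2) \<le> rate 1"
    proof (rule rate_mono)
      show "u t \<le> threshold t" if "1 / 2 < t" "t < 1" for t
      proof -
        have "t \<notin> T" using T by simp
        then show ?thesis using that by (auto simp: T_def)
      qed
    qed auto
    then show False using half r0 by simp
  qed
  then obtain t0 where t0: "t0 \<in> T" by blast
  have bdd: "bdd_below T" by (auto simp: T_def intro!: bdd_belowI[of _ 0])
  have \<tau>_le: "\<tau> \<le> t" if "t \<in> T" for t unfolding \<tau>_def by (rule cInf_lower[OF that bdd])
  have \<tau>1: "\<tau> < 1" using \<tau>_le[OF t0] t0 by (auto simp: T_def)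
  have \<tau>_ge: "0 \<le> \<tau>" unfolding \<tau>_def using \<open>T \<noteq> {}\<close> by (intro cInf_greatest) (auto simp: T_def)
  have below: "u t \<le> threshold t" if "0 < t" "t < \<tau>" for t
  proof -
    have "t \<notin> T" using \<tau>_le[of t] that by auto
    then show ?thesis using that \<tau>1 by (auto simp: T_def)
  qed
  have after: "threshold t \<le> u t" if "\<tau> < t" "t < 1" for t
  proof -
    obtain r where r: "r \<in> T" "r < t" using cInf_lessD[of T t] \<open>T \<noteq> {}\<close> \<open>\<tau> < t\<close> by (auto simp: \<tau>_def)
    then show ?thesis using threshold_crossing[OF sc, of r t] that by (auto simp: T_def)
  qed
  \<comment> \<open>Otherwise \<open>rate\<close> would be non-increasing on
    \<open>[0, 1/2]\<close>, from 0 to a positive value.\<close>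
  have "\<tau> \<noteq> 0"
  proof
    assume "\<tau> = 0"
    then have "rate (1 / 2) \<le> rate 0" by (intro rate_antimono) (auto intro: after)
    then show False using half r0 by simp
  qed
  then have \<tau>: "\<tau> \<in> {0<..<1}" using \<tau>_ge \<tau>1 by simp
  have "mono_on {0..<\<tau>} (deriv01 p)"
  proof (rule mono_onI)
    fix x y assume "x \<in> {0..<\<tau>}" "y \<in> {0..<\<tau>}" "x \<le> y"
    then show "deriv01 p x \<le> deriv01 p y"
      using \<tau>1 rate_mono[of x y] below by (simp add: deriv01_p)
  qed
  moreover have "antimono_on {\<tau><..1} (deriv01 p)"
  proof (rule monotone_onI)
    fix x y assume "x \<in> {\<tau><..1}" "y \<in> {\<tau><..1}" "x \<le> y"
    then show "deriv01 p y \<le> deriv01 p x"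
      using \<tau>_ge rate_antimono[of x y] after by (simp add: deriv01_p)
  qed
  moreover have "p differentiable_on {0..1}"
    unfolding differentiable_on_def using p_has_derivative real_differentiable_def by blast
  ultimately show ?thesis unfolding sigmoidal_def using \<tau> by blast
qed

end

theorem proposition3:
  fixes u p :: "real \<Rightarrow> real"
  assumes "mono_on {0..1} u"
    and "piecewise_continuous u"
    and "single_crossing u"
    and "optimal_solution u p"
    and "interior_path p"
  shows "sigmoidal p"
proof -
  interpret interior_optimum u p using assms by unfold_locales
  show ?thesis by (rule sigmoidal_p[OF assms(3)])
qed

end
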